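(* Let $M$ be a Riemannian manifold with a vector field $\zeta$, a function $\beta\in C(M)$ and a conformal Killing vector field $\tau$, and let $A=C(M)\rtimes_\tau\mathbb{R}$ with its first order calculus $(\Omega^1(A),\mathrm d)$ be as in the context. (1) Natural relations in $\Omega^2(A)$ are provided by \[\{\theta',\mathrm dt\}=-\lambda\,\mathrm d\theta',\quad(\mathrm dt)^2=-\tfrac\lambda2\mathrm d(\beta\theta'),\quad[\mathrm d\theta',t]=\lambda\,\mathrm d\big((\alpha-1)\theta'\big),\] \[\{\omega,\mathrm dt\}=-\lambda\,\mathrm d\omega,\quad\mathrm d\big((\tau\beta+\beta(\alpha-1))\theta'\big)=0\] for all $\omega\in\bar\Omega^1$, in addition to the relations \[\{\omega,\theta'\}=\theta'^2=0,\qquad[\mathrm d\theta',f]=0,\qquad\{\omega,\eta\}=\lambda\theta'(\bar\nabla_\omega\eta+\bar\nabla_\eta\omega)-\lambda(\omega,\eta)\,\mathrm d\theta'\] for all $\omega,\eta\in\bar\Omega^1$ and $f\in C(M)$, already present for the calculus on $M$. (2) Given $\mu,\nu\in C(M)$ with $\tau(\mu)=\beta-(1+\alpha)\mu$ and $\tau(\nu)=\mu-\alpha\nu$, the calculus is inner if the last of the five relations displayed first in (1), namely $\mathrm d((\tau\beta+\beta(\alpha-1))\theta')=0$, is replaced by the stronger $\mathrm d((\beta-(\mu+\nu))\theta')=0$. Here \[\theta:=\mathrm dt-(\mu+\nu)\theta',\qquad[\theta,\ \}=-\lambda\,\mathrm d,\] where $[\ ,\ \}$ denotes the commutator on degree 0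 and the anticommutator on degree 1.
   Context: $C(M)$: smooth functions on $M$; $\bar\Omega^1$: classical 1-forms; $\bar{\mathrm d}$: classical exterior derivative; $\bar g$: metric; $(\ ,\ )$: inverse metric on 1-forms; $\bar\nabla$: Levi-Civita connection, with $\bar\nabla_\omega:=\bar\nabla_{\omega^*}$ for the vector field $\omega^*=(\omega,\ )$; $\bar\Delta f=\bar\Delta_{LB}f+\zeta(f)$ with $\bar\Delta_{LB}$ the Laplace-Beltrami operator; $\zeta^*$ the 1-form corresponding to $\zeta$ under the metric; $n=\dim M$; $\alpha=\frac2n\mathrm{div}(\tau)-1$; $\bar{\mathcal L}$ the Lie derivative; $\lambda$ the deformation parameter. $A=C(M)\rtimes_\tau\mathbb{R}$ is generated by $C(M)$ and a variable $t$ with $[f,t]=\lambda\tau(f)$ for $f\in C(M)$. $\Omega^1(A)$ is the $A$-bimodule generated by $\bar\Omega^1,\theta',\mathrm dt$ with, for $\omega\in\bar\Omega^1$, $f\in C(M)$, \[[\omega,f]=\lambda(\omega,\bar{\mathrm d}f)\theta',\quad[\theta',f]=0,\quad[\theta',t]=\alpha\lambda\theta',\quad[f,\mathrm dt]=\lambda\,\mathrm df,\quad[\mathrm dt,t]=\beta\lambda\theta'-\lambda\,\mathrm dt,\] \[[\omega,t]=\lambda(\bar{\mathcal L}_\tau-\mathrm{id})\omega-\lambda^2\tfrac{n-2}4(\bar{\mathrm d}\alpha,\omega)\theta'-\tfrac{\lambda^2}2(\bar{\mathcal L}_\tau\zeta^*,\omega)\theta',\] and $\mathrm d:A\to\Omega^1(A)$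 a derivation with $\mathrm df=\bar{\mathrm d}f+\frac\lambda2(\bar\Delta f)\theta'$ for $f\in C(M)$. As is normally required of a calculus, elements $a\,\mathrm db$ are taken to span $\Omega^1(A)$. $\Omega^2(A)$ denotes a space of 2-forms extending this calculus, with $\mathrm d$ extended as a graded derivation with $\mathrm d^2=0$; any such extension generated by the calculus is a quotient of the maximal prolongation (the extension obtained by these minimal requirements alone) by further relations. Products of 1-forms are taken in $\Omega^2(A)$ and $\{\ ,\ \}$ is the anticommutator. "Inner" means that $\mathrm d$ is generated by the 1-form $\theta$ through the (graded) commutator, $[\theta,a]=-\lambda\,\mathrm da$ for $a\in A$ and $\{\theta,\omega\}=-\lambda\,\mathrm d\omega$ for $\omega\in\Omega^1(A)$. *)

theory Defs
  imports
    "HOL-Analysis.Analysis"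
    "HOL-Library.Function_Algebras"
    "HOL-Algebra.Module"
    "HOL-Algebra.Generated_Groups"
begin

section \<open>Smooth manifolds\<close>

type_synonym 'm scalar_fn = "'m \<Rightarrow> real"
type_synonym 'm vfield = "'m scalar_fn \<Rightarrow> 'm scalar_fn"
type_synonym 'm oneform = "'m vfield \<Rightarrow> 'm scalar_fn"

text \<open>\<open>C_upto k S f\<close>: on the open set \<open>S\<close>, \<open>f\<close> is \<open>k\<close> times continuously differentiable.\<close>

fun C_upto :: "nat \<Rightarrow> (real^'n::finite) set \<Rightarrow> (real^'n \<Rightarrow> real) \<Rightarrow> bool" where
  "C_upto 0 S f \<longleftrightarrow> continuous_on S f"
| "C_upto (Suc k) S f \<longleftrightarrow>
     (\<forall>x\<in>S. f differentiable (at x)) \<and>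
     (\<forall>i. C_upto k S (\<lambda>x. frechet_derivative f (at x) (axis i 1)))"

definition smooth_on :: "(real^'n::finite) set \<Rightarrow> (real^'n \<Rightarrow> real) \<Rightarrow> bool" where
  "smooth_on S f \<longleftrightarrow> (\<forall>k. C_upto k S f)"

definition smooth_atlas ::
  "('m::{t2_space,second_countable_topology} set \<times> ('m \<Rightarrow> real^'n::finite)) set \<Rightarrow> bool" where
  "smooth_atlas \<A> \<longleftrightarrow>
     (\<Union>(U,\<phi>)\<in>\<A>. U) = UNIV \<and>
     (\<forall>(U,\<phi>)\<in>\<A>. open U \<and> open (\<phi> ` U) \<and> (\<exists>\<psi>. homeomorphism U (\<phi> ` U) \<phi> \<psi>)) \<and>
     (\<forall>(U,\<phi>)\<in>\<A>. \<forall>(V,\<psi>)\<in>\<A>. \<forall>i.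
        smooth_on (\<phi> ` (U \<inter> V)) (\<lambda>x. \<psi> (inv_into U \<phi> x) $ i))"

text \<open>
  The point set of the manifold is the type \<open>'m\<close>, its dimension is \<open>CARD('n)\<close>.  The fields
  \<open>sharp\<close>, \<open>nabla\<close> and \<open>divg\<close> are the musical isomorphism from 1-forms to vector fields, the
  Levi-Civita connection and the divergence.  They are determined by the atlas and the metric; the
  record names them, and \<open>riemannian_manifold\<close> below imposes their defining properties.
\<close>

record ('m, 'n) riemannian =
  charts :: "('m set \<times> ('m \<Rightarrow> real^'n)) set"
  metric :: "'m vfield \<Rightarrow> 'm vfield \<Rightarrow> 'm scalar_fn"
  sharp :: "'m oneform \<Rightarrow> 'm vfield"
  nabla :: "'m vfield \<Rightarrow> 'm vfield \<Rightarrow> 'm vfield"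
  divg :: "'m vfield \<Rightarrow> 'm scalar_fn"

definition smooth_functions :: "('m, 'n::finite) riemannian \<Rightarrow> 'm scalar_fn set" where
  "smooth_functions M =
     {f. \<forall>(U,\<phi>)\<in>charts M. smooth_on (\<phi> ` U) (\<lambda>x. f (inv_into U \<phi> x))}"

text \<open>Multiplication of a vector field or of a 1-form by a function.\<close>

definition fmul :: "'m scalar_fn \<Rightarrow> ('b \<Rightarrow> 'm scalar_fn) \<Rightarrow> 'b \<Rightarrow> 'm scalar_fn"
    (infixr \<open>\<rightharpoondown>\<close> 75) where
  "fmul f X = (\<lambda>h. f * X h)"

text \<open>
  Vector fields are the derivations of the algebra of smooth functions, and 1-forms are the
  function-linear maps from vector fields to functions.  Both are set to \<open>0\<close> outside
  their intended domain so that HOL equality is equality of vector fields and of 1-forms.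
\<close>

definition vector_fields :: "('m, 'n::finite) riemannian \<Rightarrow> 'm vfield set" where
  "vector_fields M =
     {X. (\<forall>f\<in>smooth_functions M. X f \<in> smooth_functions M) \<and>
         (\<forall>f\<in>smooth_functions M. \<forall>h\<in>smooth_functions M. X (f + h) = X f + X h) \<and>
         (\<forall>c. \<forall>f\<in>smooth_functions M. X ((\<lambda>_. c) * f) = (\<lambda>_. c) * X f) \<and>
         (\<forall>f\<in>smooth_functions M. \<forall>h\<in>smooth_functions M. X (f * h) = X f * h + f * X h) \<and>
         (\<forall>f. f \<notin> smooth_functions M \<longrightarrow> X f = 0)}"

definition one_forms :: "('m, 'n::finite) riemannian \<Rightarrow> 'm oneform set" where
  "one_forms M =
     {\<omega>. (\<forall>X\<in>vector_fields M. \<omega> X \<in> smooth_functions M) \<and>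
         (\<forall>X\<in>vector_fields M. \<forall>Y\<in>vector_fields M. \<omega> (X + Y) = \<omega> X + \<omega> Y) \<and>
         (\<forall>f\<in>smooth_functions M. \<forall>X\<in>vector_fields M. \<omega> (f \<rightharpoondown> X) = f * \<omega> X) \<and>
         (\<forall>X. X \<notin> vector_fields M \<longrightarrow> \<omega> X = 0)}"

definition cl_d :: "('m, 'n::finite) riemannian \<Rightarrow> 'm scalar_fn \<Rightarrow> 'm oneform" where
  "cl_d M f = (\<lambda>X. if X \<in> vector_fields M then X f else 0)"

definition lie_bracket :: "'m vfield \<Rightarrow> 'm vfield \<Rightarrow> 'm vfield" where
  "lie_bracket X Y = (\<lambda>f. X (Y f) - Y (X f))"


section \<open>Riemannian geometry\<close>

text \<open>Positivity says that \<open>g(X,X)(p) > 0\<close> whenever \<open>X\<close> does not vanish at \<open>p\<close>.\<close>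

definition riemannian_metric :: "('m, 'n::finite) riemannian \<Rightarrow> bool" where
  "riemannian_metric M \<longleftrightarrow>
     (\<forall>X\<in>vector_fields M. \<forall>Y\<in>vector_fields M.
        metric M X Y \<in> smooth_functions M \<and> metric M X Y = metric M Y X) \<and>
     (\<forall>X\<in>vector_fields M. \<forall>Y\<in>vector_fields M. \<forall>Z\<in>vector_fields M.
        metric M (X + Y) Z = metric M X Z + metric M Y Z) \<and>
     (\<forall>f\<in>smooth_functions M. \<forall>X\<in>vector_fields M. \<forall>Y\<in>vector_fields M.
        metric M (f \<rightharpoondown> X) Y = f * metric M X Y) \<and>
     (\<forall>X\<in>vector_fields M. \<forall>p. (\<exists>f\<in>smooth_functions M. X f p \<noteq> 0) \<longrightarrow> metric M X X p > 0)"

definition is_sharp :: "('m, 'n::finite) riemannian \<Rightarrow> bool" where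
  "is_sharp M \<longleftrightarrow>
     (\<forall>\<omega>\<in>one_forms M. sharp M \<omega> \<in> vector_fields M \<and>
        (\<forall>X\<in>vector_fields M. metric M (sharp M \<omega>) X = \<omega> X))"

definition levi_civita :: "('m, 'n::finite) riemannian \<Rightarrow> bool" where
  "levi_civita M \<longleftrightarrow>
     (\<forall>X\<in>vector_fields M. \<forall>Y\<in>vector_fields M. nabla M X Y \<in> vector_fields M) \<and>
     (\<forall>X\<in>vector_fields M. \<forall>Y\<in>vector_fields M. \<forall>Z\<in>vector_fields M.
        nabla M (X + Y) Z = nabla M X Z + nabla M Y Z \<and>
        nabla M X (Y + Z) = nabla M X Y + nabla M X Z) \<and>
     (\<forall>f\<in>smooth_functions M. \<forall>X\<in>vector_fields M. \<forall>Y\<in>vector_fields M.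
        nabla M (f \<rightharpoondown> X) Y = f \<rightharpoondown> nabla M X Y \<and>
        nabla M X (f \<rightharpoondown> Y) = (X f \<rightharpoondown> Y) + (f \<rightharpoondown> nabla M X Y)) \<and>
     (\<forall>X\<in>vector_fields M. \<forall>Y\<in>vector_fields M.
        nabla M X Y - nabla M Y X = lie_bracket X Y) \<and>
     (\<forall>X\<in>vector_fields M. \<forall>Y\<in>vector_fields M. \<forall>Z\<in>vector_fields M.
        X (metric M Y Z) = metric M (nabla M X Y) Z + metric M Y (nabla M X Z))"

definition orthonormal_at ::
  "('m, 'n::finite) riemannian \<Rightarrow> 'm \<Rightarrow> ('n \<Rightarrow> 'm vfield) \<Rightarrow> bool" where
  "orthonormal_at M p E \<longleftrightarrow>
     (\<forall>i. E i \<in> vector_fields M) \<and>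
     (\<forall>i j. metric M (E i) (E j) p = (if i = j then 1 else 0))"

text \<open>\<open>div X\<close> at \<open>p\<close> is the trace of \<open>v \<mapsto> \<nabla>\<^sub>v X\<close> on the tangent space at \<open>p\<close>.\<close>

definition is_divergence :: "('m, 'n::finite) riemannian \<Rightarrow> bool" where
  "is_divergence M \<longleftrightarrow>
     (\<forall>X\<in>vector_fields M. divg M X \<in> smooth_functions M \<and>
        (\<forall>p E. orthonormal_at M p E \<longrightarrow>
           divg M X p = (\<Sum>i\<in>UNIV. metric M (nabla M (E i) X) (E i) p)))"

definition riemannian_manifold ::
  "('m::{t2_space,second_countable_topology}, 'n::finite) riemannian \<Rightarrow> bool" where
  "riemannian_manifold M \<longleftrightarrow>
     smooth_atlas (charts M) \<and> riemannian_metric M \<and> is_sharp M \<and> levi_civita M \<and>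
     is_divergence M"

definition flat :: "('m, 'n::finite) riemannian \<Rightarrow> 'm vfield \<Rightarrow> 'm oneform" where
  "flat M X = (\<lambda>Y. if Y \<in> vector_fields M then metric M X Y else 0)"

definition inv_metric ::
  "('m, 'n::finite) riemannian \<Rightarrow> 'm oneform \<Rightarrow> 'm oneform \<Rightarrow> 'm scalar_fn" where
  "inv_metric M \<omega> \<eta> = metric M (sharp M \<omega>) (sharp M \<eta>)"

text \<open>
  The covariant derivative \<open>\<nabla>\<^sub>\<omega> \<eta>\<close> of the 1-form \<open>\<eta>\<close> along the vector field \<open>sharp \<omega>\<close>, which is
  the vector field \<open>f \<mapsto> (\<omega>, df)\<close>.
\<close>

definition nabla_form ::
  "('m, 'n::finite) riemannian \<Rightarrow> 'm oneform \<Rightarrow> 'm oneform \<Rightarrow> 'm oneform" where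
  "nabla_form M \<omega> \<eta> =
     (\<lambda>Y. if Y \<in> vector_fields M
          then sharp M \<omega> (\<eta> Y) - \<eta> (nabla M (sharp M \<omega>) Y) else 0)"

definition laplace_beltrami :: "('m, 'n::finite) riemannian \<Rightarrow> 'm scalar_fn \<Rightarrow> 'm scalar_fn" where
  "laplace_beltrami M f = divg M (sharp M (cl_d M f))"

definition drift_laplacian ::
  "('m, 'n::finite) riemannian \<Rightarrow> 'm vfield \<Rightarrow> 'm scalar_fn \<Rightarrow> 'm scalar_fn" where
  "drift_laplacian M \<zeta> f = laplace_beltrami M f + \<zeta> f"

definition lie_form ::
  "('m, 'n::finite) riemannian \<Rightarrow> 'm vfield \<Rightarrow> 'm oneform \<Rightarrow> 'm oneform" where
  "lie_form M \<tau> \<omega> =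
     (\<lambda>X. if X \<in> vector_fields M then \<tau> (\<omega> X) - \<omega> (lie_bracket \<tau> X) else 0)"

definition lie_metric ::
  "('m, 'n::finite) riemannian \<Rightarrow> 'm vfield \<Rightarrow> 'm vfield \<Rightarrow> 'm vfield \<Rightarrow> 'm scalar_fn" where
  "lie_metric M \<tau> X Y =
     \<tau> (metric M X Y) - metric M (lie_bracket \<tau> X) Y - metric M X (lie_bracket \<tau> Y)"

definition conformal_killing :: "('m, 'n::finite) riemannian \<Rightarrow> 'm vfield \<Rightarrow> bool" where
  "conformal_killing M \<tau> \<longleftrightarrow>
     \<tau> \<in> vector_fields M \<and>
     (\<exists>\<phi>\<in>smooth_functions M. \<forall>X\<in>vector_fields M. \<forall>Y\<in>vector_fields M.
        lie_metric M \<tau> X Y = \<phi> * metric M X Y)"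

text \<open>\<open>\<alpha> = (2/n) div \<tau> - 1\<close>\<close>

definition alpha :: "('m, 'n::finite) riemannian \<Rightarrow> 'm vfield \<Rightarrow> 'm scalar_fn" where
  "alpha M \<tau> = (\<lambda>p. 2 / real CARD('n) * divg M \<tau> p - 1)"


section \<open>Bimodules\<close>

record ('a, 'b) bimod = "('a, 'b) module" +
  rsmult :: "'b \<Rightarrow> 'a \<Rightarrow> 'b" (infixl \<open>\<star>\<index>\<close> 70)

definition bimodule :: "'a ring \<Rightarrow> ('a, 'b, 'z) bimod_scheme \<Rightarrow> bool" where
  "bimodule A B \<longleftrightarrow> ring A \<and> abelian_group B \<and>
     (\<forall>a\<in>carrier A. \<forall>x\<in>carrier B. a \<odot>\<^bsub>B\<^esub> x \<in> carrier B \<and> x \<star>\<^bsub>B\<^esub> a \<in> carrier B) \<and>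
     (\<forall>x\<in>carrier B. \<one>\<^bsub>A\<^esub> \<odot>\<^bsub>B\<^esub> x = x \<and> x \<star>\<^bsub>B\<^esub> \<one>\<^bsub>A\<^esub> = x) \<and>
     (\<forall>a\<in>carrier A. \<forall>b\<in>carrier A. \<forall>x\<in>carrier B.
        (a \<oplus>\<^bsub>A\<^esub> b) \<odot>\<^bsub>B\<^esub> x = (a \<odot>\<^bsub>B\<^esub> x) \<oplus>\<^bsub>B\<^esub> (b \<odot>\<^bsub>B\<^esub> x) \<and>
        x \<star>\<^bsub>B\<^esub> (a \<oplus>\<^bsub>A\<^esub> b) = (x \<star>\<^bsub>B\<^esub> a) \<oplus>\<^bsub>B\<^esub> (x \<star>\<^bsub>B\<^esub> b) \<and>
        (a \<otimes>\<^bsub>A\<^esub> b) \<odot>\<^bsub>B\<^esub> x = a \<odot>\<^bsub>B\<^esub> (b \<odot>\<^bsub>B\<^esub> x) \<and>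
        x \<star>\<^bsub>B\<^esub> (a \<otimes>\<^bsub>A\<^esub> b) = (x \<star>\<^bsub>B\<^esub> a) \<star>\<^bsub>B\<^esub> b \<and>
        (a \<odot>\<^bsub>B\<^esub> x) \<star>\<^bsub>B\<^esub> b = a \<odot>\<^bsub>B\<^esub> (x \<star>\<^bsub>B\<^esub> b)) \<and>
     (\<forall>a\<in>carrier A. \<forall>x\<in>carrier B. \<forall>y\<in>carrier B.
        a \<odot>\<^bsub>B\<^esub> (x \<oplus>\<^bsub>B\<^esub> y) = (a \<odot>\<^bsub>B\<^esub> x) \<oplus>\<^bsub>B\<^esub> (a \<odot>\<^bsub>B\<^esub> y) \<and>
        (x \<oplus>\<^bsub>B\<^esub> y) \<star>\<^bsub>B\<^esub> a = (x \<star>\<^bsub>B\<^esub> a) \<oplus>\<^bsub>B\<^esub> (y \<star>\<^bsub>B\<^esub> a))"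

text \<open>\<open>[x, a]\<close> for \<open>x\<close> in a bimodule and \<open>a\<close> in the algebra; \<open>[a, x]\<close> is \<open>\<ominus> [x, a]\<close>.\<close>

definition bcomm :: "('a, 'b, 'z) bimod_scheme \<Rightarrow> 'b \<Rightarrow> 'a \<Rightarrow> 'b" where
  "bcomm B x a = (x \<star>\<^bsub>B\<^esub> a) \<ominus>\<^bsub>B\<^esub> (a \<odot>\<^bsub>B\<^esub> x)"


section \<open>The algebra and its first order calculus\<close>

text \<open>
  \<open>emb\<close> and \<open>emb1\<close> are the maps from functions and classical 1-forms on the manifold to the algebra
  and to its bimodule of 1-forms, \<open>tvar\<close> is the generator \<open>t\<close>, \<open>dd\<close> the exterior derivative on the
  algebra and \<open>thetap\<close> is \<open>\<theta>'\<close>.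
\<close>

record ('m, 'a, 'w) calculus =
  alg :: "'a ring"
  emb :: "'m scalar_fn \<Rightarrow> 'a"
  tvar :: 'a
  forms1 :: "('a, 'w) bimod"
  emb1 :: "'m oneform \<Rightarrow> 'w"
  thetap :: 'w
  dd :: "'a \<Rightarrow> 'w"

definition dt :: "('m, 'a, 'w) calculus \<Rightarrow> 'w" where
  "dt K = dd K (tvar K)"

definition rscal :: "('m, 'a, 'w) calculus \<Rightarrow> real \<Rightarrow> 'a" where
  "rscal K c = emb K (\<lambda>_. c)"

text \<open>\<open>f \<theta>'\<close> for a function \<open>f\<close> on the manifold\<close>

definition ftheta :: "('m, 'a, 'w) calculus \<Rightarrow> 'm scalar_fn \<Rightarrow> 'w" where
  "ftheta K f = emb K f \<odot>\<^bsub>forms1 K\<^esub> thetap K"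

text \<open>
  The last clause says that every element is \<open>\<Sum>\<^sub>i f\<^sub>i t\<^sup>i\<close> for a unique finitely supported family of
  functions, so that the algebra is the crossed product on the vector space of polynomials in \<open>t\<close>
  over the smooth functions.
\<close>

definition crossed_product ::
  "('m, 'n::finite) riemannian \<Rightarrow> 'm vfield \<Rightarrow> real \<Rightarrow> ('m, 'a, 'w) calculus \<Rightarrow> bool" where
  "crossed_product M \<tau> lam K \<longleftrightarrow>
     ring (alg K) \<and> tvar K \<in> carrier (alg K) \<and>
     (\<forall>f\<in>smooth_functions M. emb K f \<in> carrier (alg K)) \<and>
     emb K 1 = \<one>\<^bsub>alg K\<^esub> \<and>
     (\<forall>f\<in>smooth_functions M. \<forall>h\<in>smooth_functions M.
        emb K (f + h) = emb K f \<oplus>\<^bsub>alg K\<^esub> emb K h \<and>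
        emb K (f * h) = emb K f \<otimes>\<^bsub>alg K\<^esub> emb K h) \<and>
     (\<forall>f\<in>smooth_functions M.
        (emb K f \<otimes>\<^bsub>alg K\<^esub> tvar K) \<ominus>\<^bsub>alg K\<^esub> (tvar K \<otimes>\<^bsub>alg K\<^esub> emb K f)
          = emb K ((\<lambda>_. lam) * \<tau> f)) \<and>
     (\<forall>a\<in>carrier (alg K). \<exists>!c. (\<forall>i. c i \<in> smooth_functions M) \<and> finite {i. c i \<noteq> 0} \<and>
        a = (\<Oplus>\<^bsub>alg K\<^esub>i\<in>{i. c i \<noteq> 0}. emb K (c i) \<otimes>\<^bsub>alg K\<^esub> (tvar K [^]\<^bsub>alg K\<^esub> (i::nat))))"

text \<open>
  A first order differential calculus over the reals: a bimodule with a real linear derivation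
  such that the elements \<open>a db\<close> span.
\<close>

definition first_order_calculus :: "('m, 'a, 'w) calculus \<Rightarrow> bool" where
  "first_order_calculus K \<longleftrightarrow>
     bimodule (alg K) (forms1 K) \<and>
     (\<forall>a\<in>carrier (alg K). dd K a \<in> carrier (forms1 K)) \<and>
     (\<forall>a\<in>carrier (alg K). \<forall>b\<in>carrier (alg K).
        dd K (a \<oplus>\<^bsub>alg K\<^esub> b) = dd K a \<oplus>\<^bsub>forms1 K\<^esub> dd K b \<and>
        dd K (a \<otimes>\<^bsub>alg K\<^esub> b)
          = (dd K a \<star>\<^bsub>forms1 K\<^esub> b) \<oplus>\<^bsub>forms1 K\<^esub> (a \<odot>\<^bsub>forms1 K\<^esub> dd K b)) \<and>
     (\<forall>c. \<forall>a\<in>carrier (alg K).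
        dd K (rscal K c \<otimes>\<^bsub>alg K\<^esub> a) = rscal K c \<odot>\<^bsub>forms1 K\<^esub> dd K a) \<and>
     generate (add_monoid (forms1 K))
       {a \<odot>\<^bsub>forms1 K\<^esub> dd K b | a b. a \<in> carrier (alg K) \<and> b \<in> carrier (alg K)}
       = carrier (forms1 K)"

definition conformal_calculus ::
  "('m, 'n::finite) riemannian \<Rightarrow> 'm vfield \<Rightarrow> 'm vfield \<Rightarrow> 'm scalar_fn \<Rightarrow> real \<Rightarrow>
   ('m, 'a, 'w) calculus \<Rightarrow> bool" where
  "conformal_calculus M \<zeta> \<tau> \<beta> lam K \<longleftrightarrow>
     crossed_product M \<tau> lam K \<and> first_order_calculus K \<and>
     thetap K \<in> carrier (forms1 K) \<and>
     (\<forall>\<omega>\<in>one_forms M. emb1 K \<omega> \<in> carrier (forms1 K)) \<and>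
     (\<forall>\<omega>\<in>one_forms M. \<forall>\<eta>\<in>one_forms M.
        emb1 K (\<omega> + \<eta>) = emb1 K \<omega> \<oplus>\<^bsub>forms1 K\<^esub> emb1 K \<eta>) \<and>
     (\<forall>f\<in>smooth_functions M. \<forall>\<omega>\<in>one_forms M.
        emb1 K (f \<rightharpoondown> \<omega>) = emb K f \<odot>\<^bsub>forms1 K\<^esub> emb1 K \<omega>) \<and>
     generate (add_monoid (forms1 K))
       {(a \<odot>\<^bsub>forms1 K\<^esub> x) \<star>\<^bsub>forms1 K\<^esub> b | a x b. a \<in> carrier (alg K) \<and> b \<in> carrier (alg K) \<and>
          x \<in> emb1 K ` one_forms M \<union> {thetap K, dt K}}
       = carrier (forms1 K) \<and>
     (\<forall>\<omega>\<in>one_forms M. \<forall>f\<in>smooth_functions M.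
        bcomm (forms1 K) (emb1 K \<omega>) (emb K f)
          = ftheta K ((\<lambda>_. lam) * inv_metric M \<omega> (cl_d M f))) \<and>
     (\<forall>f\<in>smooth_functions M. bcomm (forms1 K) (thetap K) (emb K f) = \<zero>\<^bsub>forms1 K\<^esub>) \<and>
     bcomm (forms1 K) (thetap K) (tvar K) = ftheta K ((\<lambda>_. lam) * alpha M \<tau>) \<and>
     (\<forall>f\<in>smooth_functions M.
        \<ominus>\<^bsub>forms1 K\<^esub> bcomm (forms1 K) (dt K) (emb K f)
          = rscal K lam \<odot>\<^bsub>forms1 K\<^esub> dd K (emb K f)) \<and>
     bcomm (forms1 K) (dt K) (tvar K)
       = ftheta K ((\<lambda>_. lam) * \<beta>) \<ominus>\<^bsub>forms1 K\<^esub> (rscal K lam \<odot>\<^bsub>forms1 K\<^esub> dt K) \<and>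
     (\<forall>\<omega>\<in>one_forms M.
        bcomm (forms1 K) (emb1 K \<omega>) (tvar K)
          = emb1 K ((\<lambda>_. lam) \<rightharpoondown> (lie_form M \<tau> \<omega> - \<omega>))
            \<ominus>\<^bsub>forms1 K\<^esub> ftheta K ((\<lambda>_. lam\<^sup>2 * (real CARD('n) - 2) / 4)
                                * inv_metric M (cl_d M (alpha M \<tau>)) \<omega>)
            \<ominus>\<^bsub>forms1 K\<^esub> ftheta K ((\<lambda>_. lam\<^sup>2 / 2)
                                * inv_metric M (lie_form M \<tau> (flat M \<zeta>)) \<omega>)) \<and>
     (\<forall>f\<in>smooth_functions M.
        dd K (emb K f)
          = emb1 K (cl_d M f) \<oplus>\<^bsub>forms1 K\<^esub> ftheta K ((\<lambda>_. lam / 2) * drift_laplacian M \<zeta> f))"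


section \<open>Spaces of 2-forms extending the calculus\<close>

record ('a, 'w, 'e) two_forms = "('a, 'e) bimod" +
  wedge :: "'w \<Rightarrow> 'w \<Rightarrow> 'e" (infixl \<open>\<diamondop>\<index>\<close> 72)
  dif :: "'w \<Rightarrow> 'e"

definition anti :: "('a, 'w, 'e) two_forms \<Rightarrow> 'w \<Rightarrow> 'w \<Rightarrow> 'e" where
  "anti E x y = (x \<diamondop>\<^bsub>E\<^esub> y) \<oplus>\<^bsub>E\<^esub> (y \<diamondop>\<^bsub>E\<^esub> x)"

definition two_form_extension ::
  "('m, 'a, 'w) calculus \<Rightarrow> ('a, 'w, 'e) two_forms \<Rightarrow> bool" where
  "two_form_extension K E \<longleftrightarrow>
     bimodule (alg K) E \<and>
     (\<forall>x\<in>carrier (forms1 K). dif E x \<in> carrier E) \<and>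
     (\<forall>x\<in>carrier (forms1 K). \<forall>y\<in>carrier (forms1 K).
        x \<diamondop>\<^bsub>E\<^esub> y \<in> carrier E \<and>
        dif E (x \<oplus>\<^bsub>forms1 K\<^esub> y) = dif E x \<oplus>\<^bsub>E\<^esub> dif E y) \<and>
     (\<forall>x\<in>carrier (forms1 K). \<forall>y\<in>carrier (forms1 K). \<forall>z\<in>carrier (forms1 K).
        (x \<oplus>\<^bsub>forms1 K\<^esub> y) \<diamondop>\<^bsub>E\<^esub> z = (x \<diamondop>\<^bsub>E\<^esub> z) \<oplus>\<^bsub>E\<^esub> (y \<diamondop>\<^bsub>E\<^esub> z) \<and>
        x \<diamondop>\<^bsub>E\<^esub> (y \<oplus>\<^bsub>forms1 K\<^esub> z) = (x \<diamondop>\<^bsub>E\<^esub> y) \<oplus>\<^bsub>E\<^esub> (x \<diamondop>\<^bsub>E\<^esub> z)) \<and>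
     (\<forall>a\<in>carrier (alg K). \<forall>x\<in>carrier (forms1 K). \<forall>y\<in>carrier (forms1 K).
        (a \<odot>\<^bsub>forms1 K\<^esub> x) \<diamondop>\<^bsub>E\<^esub> y = a \<odot>\<^bsub>E\<^esub> (x \<diamondop>\<^bsub>E\<^esub> y) \<and>
        (x \<star>\<^bsub>forms1 K\<^esub> a) \<diamondop>\<^bsub>E\<^esub> y = x \<diamondop>\<^bsub>E\<^esub> (a \<odot>\<^bsub>forms1 K\<^esub> y) \<and>
        x \<diamondop>\<^bsub>E\<^esub> (y \<star>\<^bsub>forms1 K\<^esub> a) = (x \<diamondop>\<^bsub>E\<^esub> y) \<star>\<^bsub>E\<^esub> a) \<and>
     (\<forall>a\<in>carrier (alg K). \<forall>x\<in>carrier (forms1 K).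
        dif E (a \<odot>\<^bsub>forms1 K\<^esub> x) = (dd K a \<diamondop>\<^bsub>E\<^esub> x) \<oplus>\<^bsub>E\<^esub> (a \<odot>\<^bsub>E\<^esub> dif E x) \<and>
        dif E (x \<star>\<^bsub>forms1 K\<^esub> a) = (dif E x \<star>\<^bsub>E\<^esub> a) \<ominus>\<^bsub>E\<^esub> (x \<diamondop>\<^bsub>E\<^esub> dd K a)) \<and>
     (\<forall>a\<in>carrier (alg K). dif E (dd K a) = \<zero>\<^bsub>E\<^esub>)"

definition generated_by_products ::
  "('m, 'a, 'w) calculus \<Rightarrow> ('a, 'w, 'e) two_forms \<Rightarrow> bool" where
  "generated_by_products K E \<longleftrightarrow>
     generate (add_monoid E)
       {x \<diamondop>\<^bsub>E\<^esub> y | x y. x \<in> carrier (forms1 K) \<and> y \<in> carrier (forms1 K)} = carrier E"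

text \<open>
  Morphisms of extensions over the identity of the first order calculus.  If \<open>E\<close> is generated by
  products there is at most one such map on \<open>carrier E\<close>.  An extension generated by products that
  satisfies given relations and maps to every other extension satisfying them is the maximal
  prolongation divided by exactly these relations.  A 2-form in such an extension can be identified
  with the set of all finite formal sums of products \<open>x y\<close> that represent it, so it can always be
  realised on a carrier of type \<open>('w \<times> 'w) list set\<close>.
\<close>

definition extension_hom ::
  "('m, 'a, 'w) calculus \<Rightarrow> ('a, 'w, 'e) two_forms \<Rightarrow> ('a, 'w, 'f) two_forms \<Rightarrow> ('e \<Rightarrow> 'f) \<Rightarrow> bool"
  where
  "extension_hom K E F h \<longleftrightarrow>
     (\<forall>u\<in>carrier E. h u \<in> carrier F) \<and>
     (\<forall>u\<in>carrier E. \<forall>v\<in>carrier E. h (u \<oplus>\<^bsub>E\<^esub> v) = h u \<oplus>\<^bsub>F\<^esub> h v) \<and>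
     (\<forall>a\<in>carrier (alg K). \<forall>u\<in>carrier E.
        h (a \<odot>\<^bsub>E\<^esub> u) = a \<odot>\<^bsub>F\<^esub> h u \<and> h (u \<star>\<^bsub>E\<^esub> a) = h u \<star>\<^bsub>F\<^esub> a) \<and>
     (\<forall>x\<in>carrier (forms1 K). h (dif E x) = dif F x) \<and>
     (\<forall>x\<in>carrier (forms1 K). \<forall>y\<in>carrier (forms1 K). h (x \<diamondop>\<^bsub>E\<^esub> y) = x \<diamondop>\<^bsub>F\<^esub> y)"

definition manifold_relations ::
  "('m, 'n::finite) riemannian \<Rightarrow> real \<Rightarrow> ('m, 'a, 'w) calculus \<Rightarrow> ('a, 'w, 'e) two_forms \<Rightarrow> bool"
  where
  "manifold_relations M lam K E \<longleftrightarrow>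
     (\<forall>\<omega>\<in>one_forms M. anti E (emb1 K \<omega>) (thetap K) = \<zero>\<^bsub>E\<^esub>) \<and>
     thetap K \<diamondop>\<^bsub>E\<^esub> thetap K = \<zero>\<^bsub>E\<^esub> \<and>
     (\<forall>f\<in>smooth_functions M. bcomm E (dif E (thetap K)) (emb K f) = \<zero>\<^bsub>E\<^esub>) \<and>
     (\<forall>\<omega>\<in>one_forms M. \<forall>\<eta>\<in>one_forms M.
        anti E (emb1 K \<omega>) (emb1 K \<eta>)
          = (rscal K lam \<odot>\<^bsub>E\<^esub> (thetap K \<diamondop>\<^bsub>E\<^esub> emb1 K (nabla_form M \<omega> \<eta> + nabla_form M \<eta> \<omega>)))
            \<ominus>\<^bsub>E\<^esub> (emb K ((\<lambda>_. lam) * inv_metric M \<omega> \<eta>) \<odot>\<^bsub>E\<^esub> dif E (thetap K)))"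

definition rel_theta_dt ::
  "real \<Rightarrow> ('m, 'a, 'w) calculus \<Rightarrow> ('a, 'w, 'e) two_forms \<Rightarrow> bool" where
  "rel_theta_dt lam K E \<longleftrightarrow>
     anti E (thetap K) (dt K) = \<ominus>\<^bsub>E\<^esub> (rscal K lam \<odot>\<^bsub>E\<^esub> dif E (thetap K))"

definition rel_dt_dt ::
  "'m scalar_fn \<Rightarrow> real \<Rightarrow> ('m, 'a, 'w) calculus \<Rightarrow> ('a, 'w, 'e) two_forms \<Rightarrow> bool" where
  "rel_dt_dt \<beta> lam K E \<longleftrightarrow>
     dt K \<diamondop>\<^bsub>E\<^esub> dt K = \<ominus>\<^bsub>E\<^esub> (rscal K (lam / 2) \<odot>\<^bsub>E\<^esub> dif E (ftheta K \<beta>))"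

definition rel_dtheta_t ::
  "('m, 'n::finite) riemannian \<Rightarrow> 'm vfield \<Rightarrow> real \<Rightarrow>
   ('m, 'a, 'w) calculus \<Rightarrow> ('a, 'w, 'e) two_forms \<Rightarrow> bool" where
  "rel_dtheta_t M \<tau> lam K E \<longleftrightarrow>
     bcomm E (dif E (thetap K)) (tvar K)
       = rscal K lam \<odot>\<^bsub>E\<^esub> dif E (ftheta K (alpha M \<tau> - 1))"

definition rel_form_dt ::
  "real \<Rightarrow> ('m, 'a, 'w) calculus \<Rightarrow> ('a, 'w, 'e) two_forms \<Rightarrow> 
   'm oneform \<Rightarrow> bool" where
  "rel_form_dt lam K E \<omega> \<longleftrightarrow>
     anti E (emb1 K \<omega>) (dt K) = \<ominus>\<^bsub>E\<^esub> (rscal K lam \<odot>\<^bsub>E\<^esub> dif E (emb1 K \<omega>))"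

definition rel_closed ::
  "('m, 'a, 'w) calculus \<Rightarrow> ('a, 'w, 'e) two_forms \<Rightarrow> 'm scalar_fn \<Rightarrow> bool" where
  "rel_closed K E h \<longleftrightarrow> dif E (ftheta K h) = \<zero>\<^bsub>E\<^esub>"

text \<open>
  \<open>h\<close> is the function for which \<open>d(h \<theta>') = 0\<close> is imposed.
\<close>

definition natural_relations ::
  "('m, 'n::finite) riemannian \<Rightarrow> 'm vfield \<Rightarrow> 'm scalar_fn \<Rightarrow> real \<Rightarrow> 'm scalar_fn \<Rightarrow>
   ('m, 'a, 'w) calculus \<Rightarrow> ('a, 'w, 'e) two_forms \<Rightarrow> bool" where
  "natural_relations M \<tau> \<beta> lam h K E \<longleftrightarrow>
     manifold_relations M lam K E \<and>
     rel_theta_dt lam K E \<and> rel_dt_dt \<beta> lam K E \<and> rel_dtheta_t M \<tau> lam K E \<and>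
     (\<forall>\<omega>\<in>one_forms M. rel_form_dt lam K E \<omega>) \<and>
     rel_closed K E h"

definition inner_by ::
  "real \<Rightarrow> ('m, 'a, 'w) calculus \<Rightarrow> ('a, 'w, 'e) two_forms \<Rightarrow> 'w \<Rightarrow> bool" where
  "inner_by lam K E \<theta> \<longleftrightarrow>
     \<theta> \<in> carrier (forms1 K) \<and>
     (\<forall>a\<in>carrier (alg K).
        bcomm (forms1 K) \<theta> a = \<ominus>\<^bsub>forms1 K\<^esub> (rscal K lam \<odot>\<^bsub>forms1 K\<^esub> dd K a)) \<and>
     (\<forall>x\<in>carrier (forms1 K).
        anti E \<theta> x = \<ominus>\<^bsub>E\<^esub> (rscal K lam \<odot>\<^bsub>E\<^esub> dif E x))"

end

theory Submission
  imports Defs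
begin

text \<open>
  All relations come from two identities that hold in every extension of the calculus,
  \<open>d[x,a] = [dx,a] - {x,da}\<close> (\<open>dif_bcomm\<close>) and \<open>{ax,y} = a{x,y} + [y,a]x\<close> (\<open>anti_lact\<close>), applied to the
  commutation relations in degree 1.  Differentiating \<open>[dt,t]\<close> gives \<open>(dt)\<^sup>2\<close>, differentiating
  \<open>[f,dt]\<close> gives \<open>{df,dt} = 0\<close>, and differentiating \<open>[\<theta>',t]\<close> turns \<open>{\<theta>',dt} = -\<lambda> d\<theta>'\<close> into the formula
  for \<open>[d\<theta>',t]\<close>.  The second identity extends these from \<open>\<theta>'\<close> and exact forms to their multiples by
  functions.  The closedness of \<open>(\<tau>\<beta> + \<beta>(\<alpha>-1))\<theta>'\<close> is a consistency condition: \<open>t\<close> commutes with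
  \<open>(dt)\<^sup>2\<close>, because \<open>[(dt)\<^sup>2,t] = {[dt,t],dt}\<close> vanishes by the relations already found, so it commutes
  with \<open>d(\<beta>\<theta>')\<close>; but the commutator of \<open>d(\<beta>\<theta>')\<close> with \<open>t\<close> is \<open>\<lambda> d((\<tau>\<beta> + \<beta>(\<alpha>-1))\<theta>')\<close>.

  Now let \<open>s = \<mu> + \<nu>\<close>, so that \<open>\<tau>s + \<alpha>s = \<beta>\<close>, and \<open>\<theta> = dt - s\<theta>'\<close>.  Both \<open>[\<theta>,-]\<close> and \<open>-\<lambda> d\<close> are
  derivations on the algebra, and the equation for \<open>s\<close> says that they agree on the generator \<open>t\<close>; on
  functions they agree anyway.  Differentiating \<open>[\<theta>,b] = -\<lambda> db\<close> gives \<open>{\<theta>,db} = [d\<theta>,b]\<close>, so in degree 1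
  the calculus is inner as soon as \<open>d\<theta> = -d(s\<theta>')\<close> is central.  It commutes with functions by the
  relations of the manifold, and \<open>[d(s\<theta>'),t] = \<lambda> d((\<tau>s + s(\<alpha>-1))\<theta>') = \<lambda> d((\<beta>-s)\<theta>')\<close>, which is exactly
  what the stronger relation sets to zero.

  The universal extension with given relations consists of formal sums of products of 1-forms
  modulo the smallest congruence that makes them an extension satisfying the relations.  There
  \<open>d\<close> has to be \<open>d(\<Sum> a db) = \<Sum> da db\<close>, so that \<open>\<Sum> da db = \<Sum> da' db'\<close> whenever
  \<open>\<Sum> a db = \<Sum> a' db'\<close> is one of the generating relations.  It holds in every extension,
  whence the universal property.
\<close>

section \<open>Smooth functions on a manifold\<close>

lemma C_upto_cong:
  assumes "open S" "\<And>x. x \<in> S \<Longrightarrow> f x = g x" "C_upto k S f"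
  shows "C_upto k S g"
  using assms(2,3)
proof (induction k arbitrary: f g)
  case 0
  then show ?case by (simp cong: continuous_on_cong)
next
  case (Suc k)
  have der: "(g has_derivative frechet_derivative f (at x)) (at x)" if "x \<in> S" for x
    using Suc.prems that \<open>open S\<close>
    by (intro has_derivative_transform_within_open[of f _ x UNIV S g])
       (auto simp: frechet_derivative_works[symmetric])
  have "C_upto k S (\<lambda>x. frechet_derivative f (at x) (axis i 1))" for i
    using Suc.prems(2) by simp
  then have "C_upto k S (\<lambda>x. frechet_derivative g (at x) (axis i 1))" for i
    by (rule Suc.IH[rotated]) (simp flip: frechet_derivative_at[OF der])
  then show ?case
    using der by (auto simp: differentiable_def)
qed

lemma C_upto_SucD: "C_upto (Suc k) S f \<Longrightarrow> C_upto k S f"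
proof (induction k arbitrary: f)
  case 0
  then show ?case
    by (simp add: continuous_at_imp_continuous_on differentiable_imp_continuous_within)
next
  case (Suc k)
  show ?case
    unfolding C_upto.simps(2)[of k]
  proof (intro conjI allI)
    show "\<forall>x\<in>S. f differentiable at x"
      using Suc.prems by simp
    show "C_upto k S (\<lambda>x. frechet_derivative f (at x) (axis i 1))" for i
      using Suc.prems by (intro Suc.IH) simp
  qed
qed

lemma C_upto_const: "C_upto k S (\<lambda>_. c)"
  by (induction k arbitrary: c) auto

lemma C_upto_add:
  assumes "open S" "C_upto k S f" "C_upto k S g"
  shows "C_upto k S (\<lambda>x. f x + g x)"
  using assms(2,3)
proof (induction k arbitrary: f g)
  case 0
  then show ?case by (simp add: continuous_on_add)
next
  case (Suc k)
  have der: "((\<lambda>x. f x + g x) has_derivative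
      (\<lambda>v. frechet_derivative f (at x) v + frechet_derivative g (at x) v)) (at x)"
    if "x \<in> S" for x
    using Suc.prems that by (intro has_derivative_add) (auto simp: frechet_derivative_works[symmetric])
  have "C_upto k S (\<lambda>x. frechet_derivative f (at x) (axis i 1)
      + frechet_derivative g (at x) (axis i 1))" for i
    using Suc.prems by (intro Suc.IH) simp_all
  then have "C_upto k S (\<lambda>x. frechet_derivative (\<lambda>x. f x + g x) (at x) (axis i 1))" for i
    by (rule C_upto_cong[OF \<open>open S\<close>, rotated]) (simp flip: frechet_derivative_at[OF der])
  then show ?case
    using der by (auto simp: differentiable_def)
qed

lemma C_upto_mult:
  assumes "open S" "C_upto k S f" "C_upto k S g"
  shows "C_upto k S (\<lambda>x. f x * g x)"
  using assms(2,3)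
proof (induction k arbitrary: f g)
  case 0
  then show ?case by (simp add: continuous_on_mult)
next
  case (Suc k)
  have der: "((\<lambda>x. f x * g x) has_derivative
      (\<lambda>v. f x * frechet_derivative g (at x) v + frechet_derivative f (at x) v * g x)) (at x)"
    if "x \<in> S" for x
    using Suc.prems that by (intro has_derivative_mult) (auto simp: frechet_derivative_works[symmetric])
  have "C_upto k S (\<lambda>x. f x * frechet_derivative g (at x) (axis i 1)
      + frechet_derivative f (at x) (axis i 1) * g x)" for i
    using Suc.prems C_upto_SucD[OF Suc.prems(1)] C_upto_SucD[OF Suc.prems(2)]
    by (intro C_upto_add[OF \<open>open S\<close>] Suc.IH) simp_all
  then have "C_upto k S (\<lambda>x. frechet_derivative (\<lambda>x. f x * g x) (at x) (axis i 1))" for i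
    by (rule C_upto_cong[OF \<open>open S\<close>, rotated]) (simp flip: frechet_derivative_at[OF der])
  then show ?case
    using der by (auto simp: differentiable_def)
qed

locale smooth_manifold =
  fixes M :: "('m::{t2_space,second_countable_topology}, 'n::finite) riemannian"
  assumes atlas: "smooth_atlas (charts M)"
begin

lemma open_chart_image: "(U, \<phi>) \<in> charts M \<Longrightarrow> open (\<phi> ` U)"
  using atlas unfolding smooth_atlas_def by fast

lemma smooth_const [simp, intro]: "(\<lambda>_. c) \<in> smooth_functions M"
  by (auto simp: smooth_functions_def smooth_on_def C_upto_const)

lemma smooth_add [simp, intro]:
  "f \<in> smooth_functions M \<Longrightarrow> g \<in> smooth_functions M \<Longrightarrow> f + g \<in> smooth_functions M"
  by (auto simp: smooth_functions_def smooth_on_def plus_fun_def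
      intro!: C_upto_add open_chart_image dest!: bspec)

lemma smooth_mult [simp, intro]:
  "f \<in> smooth_functions M \<Longrightarrow> g \<in> smooth_functions M \<Longrightarrow> f * g \<in> smooth_functions M"
  by (auto simp: smooth_functions_def smooth_on_def times_fun_def
      intro!: C_upto_mult open_chart_image dest!: bspec)

lemma smooth_one [simp, intro]: "1 \<in> smooth_functions M"
  using smooth_const[of 1] by (simp add: one_fun_def)

lemma smooth_zero [simp, intro]: "0 \<in> smooth_functions M"
  using smooth_const[of 0] by (simp add: zero_fun_def)

lemma smooth_uminus [simp, intro]: "f \<in> smooth_functions M \<Longrightarrow> - f \<in> smooth_functions M"
  using smooth_mult[of "\<lambda>_. -1" f] by (simp add: times_fun_def fun_Compl_def)

lemma smooth_diff [simp, intro]: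
  "f \<in> smooth_functions M \<Longrightarrow> g \<in> smooth_functions M \<Longrightarrow> f - g \<in> smooth_functions M"
  using smooth_add[of f "- g"] by simp

end

section \<open>Vector fields, 1-forms and Riemannian operators\<close>

locale riemannian_geometry =
  fixes M :: "('m::{t2_space,second_countable_topology}, 'n::finite) riemannian"
  assumes riemannian: "riemannian_manifold M"
begin

sublocale smooth_manifold M
  using riemannian by unfold_locales (simp add: riemannian_manifold_def)

text \<open>
  The pattern \<open>X f\<close> matches every function, so this fact and its analogue for 1-forms are kept out
  of the simplifier.
\<close>

lemma vfield_smooth:
  "X \<in> vector_fields M \<Longrightarrow> f \<in> smooth_functions M \<Longrightarrow> X f \<in> smooth_functions M"
  by (simp add: vector_fields_def)

lemma vfield_add:
  "X \<in> vector_fields M \<Longrightarrow> f \<in> smooth_functions M \<Longrightarrow> g \<in> smooth_functions M \<Longrightarrow>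
   X (f + g) = X f + X g"
  by (simp add: vector_fields_def)

lemma vfield_mult:
  "X \<in> vector_fields M \<Longrightarrow> f \<in> smooth_functions M \<Longrightarrow> g \<in> smooth_functions M \<Longrightarrow>
   X (f * g) = X f * g + f * X g"
  by (simp add: vector_fields_def)

lemma vfield_scal:
  "X \<in> vector_fields M \<Longrightarrow> f \<in> smooth_functions M \<Longrightarrow> X ((\<lambda>_. c) * f) = (\<lambda>_. c) * X f"
  by (simp add: vector_fields_def)

lemma vfield_one:
  assumes "X \<in> vector_fields M"
  shows "X 1 = 0"
  using vfield_mult[OF assms smooth_one smooth_one] by simp

lemma vfield_const:
  assumes "X \<in> vector_fields M"
  shows "X (\<lambda>_. c) = 0"
proof -
  show ?thesis
    using vfield_scal[OF assms smooth_one, of c] vfield_one[OF assms]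
    by (simp only: mult_1_right mult_zero_right)
qed

lemma vfield_outside: "X \<in> vector_fields M \<Longrightarrow> f \<notin> smooth_functions M \<Longrightarrow> X f = 0"
  by (simp add: vector_fields_def)

lemma vfield_sum [simp, intro]:
  assumes "X \<in> vector_fields M" "Y \<in> vector_fields M"
  shows "X + Y \<in> vector_fields M"
  unfolding vector_fields_def mem_Collect_eq
  using assms
  by (intro conjI ballI allI impI)
     (simp_all add: vfield_smooth vfield_add vfield_mult vfield_const vfield_outside
       fun_eq_iff algebra_simps)

lemma vfield_fmul [simp, intro]:
  assumes "f \<in> smooth_functions M" "X \<in> vector_fields M"
  shows "f \<rightharpoondown> X \<in> vector_fields M"
  unfolding vector_fields_def mem_Collect_eq fmul_def
  using assms
  by (intro conjI ballI allI impI)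
     (simp_all add: vfield_smooth vfield_add vfield_mult vfield_const vfield_outside
       fun_eq_iff algebra_simps)

lemma oneform_smooth:
  "\<omega> \<in> one_forms M \<Longrightarrow> X \<in> vector_fields M \<Longrightarrow> \<omega> X \<in> smooth_functions M"
  by (simp add: one_forms_def)

lemma oneform_add:
  "\<omega> \<in> one_forms M \<Longrightarrow> X \<in> vector_fields M \<Longrightarrow> Y \<in> vector_fields M \<Longrightarrow> \<omega> (X + Y) = \<omega> X + \<omega> Y"
  by (simp add: one_forms_def)

lemma oneform_mult:
  "\<omega> \<in> one_forms M \<Longrightarrow> f \<in> smooth_functions M \<Longrightarrow> X \<in> vector_fields M \<Longrightarrow> \<omega> (f \<rightharpoondown> X) = f * \<omega> X"
  by (simp add: one_forms_def)

lemma oneform_outside: "\<omega> \<in> one_forms M \<Longrightarrow> X \<notin> vector_fields M \<Longrightarrow> \<omega> X = 0"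
  by (simp add: one_forms_def)

lemma oneform_sum [simp, intro]:
  assumes "\<omega> \<in> one_forms M" "\<eta> \<in> one_forms M"
  shows "\<omega> + \<eta> \<in> one_forms M"
  unfolding one_forms_def mem_Collect_eq
  using assms
  by (intro conjI ballI allI impI)
     (simp_all add: vfield_smooth oneform_smooth oneform_add oneform_mult oneform_outside
       fun_eq_iff algebra_simps)

lemma cl_d_oneform [simp, intro]:
  assumes "f \<in> smooth_functions M"
  shows "cl_d M f \<in> one_forms M"
  unfolding one_forms_def mem_Collect_eq cl_d_def
  using assms
  by (intro conjI ballI allI impI) (simp_all add: vfield_smooth, simp add: fmul_def)

lemma sharp_vfield [simp, intro]:
  "\<omega> \<in> one_forms M \<Longrightarrow> sharp M \<omega> \<in> vector_fields M"
  using riemannian by (simp add: riemannian_manifold_def is_sharp_def)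

lemma inv_metric_smooth [simp, intro]:
  "\<omega> \<in> one_forms M \<Longrightarrow> \<eta> \<in> one_forms M \<Longrightarrow> inv_metric M \<omega> \<eta> \<in> smooth_functions M"
  using riemannian by (simp add: riemannian_manifold_def riemannian_metric_def inv_metric_def)

lemma divg_smooth [simp, intro]:
  "X \<in> vector_fields M \<Longrightarrow> divg M X \<in> smooth_functions M"
  using riemannian by (simp add: riemannian_manifold_def is_divergence_def)

lemma drift_laplacian_smooth [simp, intro]:
  "\<zeta> \<in> vector_fields M \<Longrightarrow> f \<in> smooth_functions M \<Longrightarrow> drift_laplacian M \<zeta> f \<in> smooth_functions M"
  by (simp add: drift_laplacian_def laplace_beltrami_def vfield_smooth)

lemma alpha_smooth [simp, intro]:
  assumes "\<tau> \<in> vector_fields M"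
  shows "alpha M \<tau> \<in> smooth_functions M"
proof -
  have "alpha M \<tau> = (\<lambda>_. 2 / real CARD('n)) * divg M \<tau> - 1"
    by (simp add: alpha_def fun_eq_iff)
  then show ?thesis
    using assms by auto
qed

text \<open>
  The two derivative terms \<open>(\<omega>\<^sup>*f) \<eta>(X)\<close> in \<open>\<omega>\<^sup>*(\<eta>(fX))\<close> and \<open>\<eta>(\<nabla>(fX))\<close> cancel, which makes \<open>\<nabla>\<^sub>\<omega>\<eta>\<close> linear
  over the functions.
\<close>

lemma nabla_form_oneform [simp, intro]:
  assumes \<omega>: "\<omega> \<in> one_forms M" and \<eta>: "\<eta> \<in> one_forms M"
  shows "nabla_form M \<omega> \<eta> \<in> one_forms M"
proof -
  let ?W = "sharp M \<omega>"
  have W: "?W \<in> vector_fields M"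
    using \<omega> by simp
  have LC: "nabla M ?W X \<in> vector_fields M"
    "nabla M ?W (X + Y) = nabla M ?W X + nabla M ?W Y"
    "f \<in> smooth_functions M \<Longrightarrow> nabla M ?W (f \<rightharpoondown> X) = (?W f \<rightharpoondown> X) + (f \<rightharpoondown> nabla M ?W X)"
    if "X \<in> vector_fields M" "Y \<in> vector_fields M" for X Y f
    using riemannian W that
    by (simp_all add: vfield_smooth oneform_smooth riemannian_manifold_def levi_civita_def)
  have add: "?W (\<eta> (X + Y)) - \<eta> (nabla M ?W (X + Y))
      = (?W (\<eta> X) - \<eta> (nabla M ?W X)) + (?W (\<eta> Y) - \<eta> (nabla M ?W Y))"
    if "X \<in> vector_fields M" "Y \<in> vector_fields M" for X Y
    unfolding LC(2)[OF that] oneform_add[OF \<eta> that]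
      oneform_add[OF \<eta> LC(1)[OF that(1,1)] LC(1)[OF that(2,2)]]
      vfield_add[OF W oneform_smooth[OF \<eta> that(1)] oneform_smooth[OF \<eta> that(2)]]
    by simp
  have mul: "?W (\<eta> (f \<rightharpoondown> X)) - \<eta> (nabla M ?W (f \<rightharpoondown> X)) = f * (?W (\<eta> X) - \<eta> (nabla M ?W X))"
    if f: "f \<in> smooth_functions M" and X: "X \<in> vector_fields M" for f X
    unfolding LC(3)[OF X X f] oneform_mult[OF \<eta> f X]
      vfield_mult[OF W f oneform_smooth[OF \<eta> X]]
      oneform_add[OF \<eta> vfield_fmul[OF vfield_smooth[OF W f] X] vfield_fmul[OF f LC(1)[OF X X]]]
      oneform_mult[OF \<eta> vfield_smooth[OF W f] X] oneform_mult[OF \<eta> f LC(1)[OF X X]]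
    by (simp add: algebra_simps)
  show ?thesis
    unfolding one_forms_def mem_Collect_eq nabla_form_def
    using W \<eta>
    by (intro conjI ballI allI impI) (simp_all add: LC(1) add mul vfield_smooth oneform_smooth)
qed

end

section \<open>Bimodules and commutators\<close>

text \<open>
  Registers the axioms with the method \<open>algebra\<close>, which then normalises sums in the additive group
  of a bimodule.
\<close>

lemmas (in abelian_group) abelian_group_simprules
  [algebra abelian_group "zero G" "add G" "a_inv G" "a_minus G"] =
  a_closed zero_closed a_inv_closed minus_closed
  a_assoc l_zero l_neg a_comm minus_eq r_zero r_neg r_neg2 r_neg1 minus_add minus_minus
  add.inv_one a_lcomm

lemma (in abelian_group) minus_eq_zero_iff:
  assumes "x \<in> carrier G" "y \<in> carrier G"
  shows "x \<ominus> y = \<zero> \<longleftrightarrow> x = y"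
proof
  assume "x \<ominus> y = \<zero>"
  moreover have "x = (x \<ominus> y) \<oplus> y"
    using assms by algebra
  ultimately show "x = y"
    using assms by simp
qed (use assms in algebra)

lemma (in abelian_group) uminus_zero [simp]: "\<ominus> \<zero> = \<zero>"
  by (rule minus_equality) simp_all

lemma (in abelian_group) add_minus_cancel:
  "\<lbrakk>x \<in> carrier G; y \<in> carrier G\<rbrakk> \<Longrightarrow> (x \<oplus> y) \<ominus> y = x"
  by algebra

lemma (in abelian_group) uminus_eq_zeroD: "\<lbrakk>\<ominus> x = \<zero>; x \<in> carrier G\<rbrakk> \<Longrightarrow> x = \<zero>"
  by (metis minus_minus uminus_zero)

lemma additive_map:
  assumes "abelian_group G" "abelian_group H"
    and closed: "\<And>x. x \<in> carrier G \<Longrightarrow> f x \<in> carrier H"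
    and add: "\<And>x y. x \<in> carrier G \<Longrightarrow> y \<in> carrier G \<Longrightarrow> f (x \<oplus>\<^bsub>G\<^esub> y) = f x \<oplus>\<^bsub>H\<^esub> f y"
  shows additive_map_zero: "f \<zero>\<^bsub>G\<^esub> = \<zero>\<^bsub>H\<^esub>"
    and additive_map_uminus: "x \<in> carrier G \<Longrightarrow> f (\<ominus>\<^bsub>G\<^esub> x) = \<ominus>\<^bsub>H\<^esub> f x"
    and additive_map_minus:
      "x \<in> carrier G \<Longrightarrow> y \<in> carrier G \<Longrightarrow> f (x \<ominus>\<^bsub>G\<^esub> y) = f x \<ominus>\<^bsub>H\<^esub> f y"
proof -
  interpret G: abelian_group G by fact
  interpret H: abelian_group H by fact
  show zero: "f \<zero>\<^bsub>G\<^esub> = \<zero>\<^bsub>H\<^esub>"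
    using add[of "\<zero>\<^bsub>G\<^esub>" "\<zero>\<^bsub>G\<^esub>"] closed[of "\<zero>\<^bsub>G\<^esub>"] H.add.l_cancel_one'[of "f \<zero>\<^bsub>G\<^esub>" "f \<zero>\<^bsub>G\<^esub>"] by auto
  show uminus: "f (\<ominus>\<^bsub>G\<^esub> x) = \<ominus>\<^bsub>H\<^esub> f x" if "x \<in> carrier G" for x
    using add[of "\<ominus>\<^bsub>G\<^esub> x" x] that closed zero
    by (intro H.minus_equality[symmetric]) (auto simp: G.l_neg)
  show "f (x \<ominus>\<^bsub>G\<^esub> y) = f x \<ominus>\<^bsub>H\<^esub> f y" if "x \<in> carrier G" "y \<in> carrier G"
    using that by (simp add: G.minus_eq H.minus_eq add uminus)
qed

locale bimod = A: ring A + B: abelian_group B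
  for A :: "'a ring" and B :: "('a, 'b, 'z) bimod_scheme" +
  assumes bimodule: "bimodule A B"
begin

lemma lact_closed [simp, intro]: "a \<in> carrier A \<Longrightarrow> x \<in> carrier B \<Longrightarrow> a \<odot>\<^bsub>B\<^esub> x \<in> carrier B"
  and ract_closed [simp, intro]: "a \<in> carrier A \<Longrightarrow> x \<in> carrier B \<Longrightarrow> x \<star>\<^bsub>B\<^esub> a \<in> carrier B"
  and lact_one [simp]: "x \<in> carrier B \<Longrightarrow> \<one>\<^bsub>A\<^esub> \<odot>\<^bsub>B\<^esub> x = x"
  and ract_one [simp]: "x \<in> carrier B \<Longrightarrow> x \<star>\<^bsub>B\<^esub> \<one>\<^bsub>A\<^esub> = x"
  using bimodule unfolding bimodule_def by blast+

lemma lact_add_left: "\<lbrakk>a \<in> carrier A; b \<in> carrier A; x \<in> carrier B\<rbrakk> \<Longrightarrow>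
    (a \<oplus>\<^bsub>A\<^esub> b) \<odot>\<^bsub>B\<^esub> x = (a \<odot>\<^bsub>B\<^esub> x) \<oplus>\<^bsub>B\<^esub> (b \<odot>\<^bsub>B\<^esub> x)"
  and ract_add_right: "\<lbrakk>a \<in> carrier A; b \<in> carrier A; x \<in> carrier B\<rbrakk> \<Longrightarrow>
    x \<star>\<^bsub>B\<^esub> (a \<oplus>\<^bsub>A\<^esub> b) = (x \<star>\<^bsub>B\<^esub> a) \<oplus>\<^bsub>B\<^esub> (x \<star>\<^bsub>B\<^esub> b)"
  and lact_mult: "\<lbrakk>a \<in> carrier A; b \<in> carrier A; x \<in> carrier B\<rbrakk> \<Longrightarrow>
    (a \<otimes>\<^bsub>A\<^esub> b) \<odot>\<^bsub>B\<^esub> x = a \<odot>\<^bsub>B\<^esub> (b \<odot>\<^bsub>B\<^esub> x)"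
  and ract_mult: "\<lbrakk>a \<in> carrier A; b \<in> carrier A; x \<in> carrier B\<rbrakk> \<Longrightarrow>
    x \<star>\<^bsub>B\<^esub> (a \<otimes>\<^bsub>A\<^esub> b) = (x \<star>\<^bsub>B\<^esub> a) \<star>\<^bsub>B\<^esub> b"
  and lact_ract: "\<lbrakk>a \<in> carrier A; b \<in> carrier A; x \<in> carrier B\<rbrakk> \<Longrightarrow>
    (a \<odot>\<^bsub>B\<^esub> x) \<star>\<^bsub>B\<^esub> b = a \<odot>\<^bsub>B\<^esub> (x \<star>\<^bsub>B\<^esub> b)"
  and lact_add: "\<lbrakk>a \<in> carrier A; x \<in> carrier B; y \<in> carrier B\<rbrakk> \<Longrightarrow>
    a \<odot>\<^bsub>B\<^esub> (x \<oplus>\<^bsub>B\<^esub> y) = (a \<odot>\<^bsub>B\<^esub> x) \<oplus>\<^bsub>B\<^esub> (a \<odot>\<^bsub>B\<^esub> y)"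
  and ract_add: "\<lbrakk>a \<in> carrier A; x \<in> carrier B; y \<in> carrier B\<rbrakk> \<Longrightarrow>
    (x \<oplus>\<^bsub>B\<^esub> y) \<star>\<^bsub>B\<^esub> a = (x \<star>\<^bsub>B\<^esub> a) \<oplus>\<^bsub>B\<^esub> (y \<star>\<^bsub>B\<^esub> a)"
  using bimodule unfolding bimodule_def by blast+

lemma lact_zero [simp]: "a \<in> carrier A \<Longrightarrow> a \<odot>\<^bsub>B\<^esub> \<zero>\<^bsub>B\<^esub> = \<zero>\<^bsub>B\<^esub>"
  and lact_uminus: "\<lbrakk>a \<in> carrier A; x \<in> carrier B\<rbrakk> \<Longrightarrow> a \<odot>\<^bsub>B\<^esub> (\<ominus>\<^bsub>B\<^esub> x) = \<ominus>\<^bsub>B\<^esub> (a \<odot>\<^bsub>B\<^esub> x)"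
  and lact_minus: "\<lbrakk>a \<in> carrier A; x \<in> carrier B; y \<in> carrier B\<rbrakk> \<Longrightarrow>
    a \<odot>\<^bsub>B\<^esub> (x \<ominus>\<^bsub>B\<^esub> y) = (a \<odot>\<^bsub>B\<^esub> x) \<ominus>\<^bsub>B\<^esub> (a \<odot>\<^bsub>B\<^esub> y)"
  using additive_map[of B B "\<lambda>x. a \<odot>\<^bsub>B\<^esub> x"] by (auto simp: lact_add B.abelian_group_axioms)

lemma ract_zero [simp]: "a \<in> carrier A \<Longrightarrow> \<zero>\<^bsub>B\<^esub> \<star>\<^bsub>B\<^esub> a = \<zero>\<^bsub>B\<^esub>"
  and ract_uminus: "\<lbrakk>a \<in> carrier A; x \<in> carrier B\<rbrakk> \<Longrightarrow> (\<ominus>\<^bsub>B\<^esub> x) \<star>\<^bsub>B\<^esub> a = \<ominus>\<^bsub>B\<^esub> (x \<star>\<^bsub>B\<^esub> a)"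
  and ract_minus: "\<lbrakk>a \<in> carrier A; x \<in> carrier B; y \<in> carrier B\<rbrakk> \<Longrightarrow>
    (x \<ominus>\<^bsub>B\<^esub> y) \<star>\<^bsub>B\<^esub> a = (x \<star>\<^bsub>B\<^esub> a) \<ominus>\<^bsub>B\<^esub> (y \<star>\<^bsub>B\<^esub> a)"
  using additive_map[of B B "\<lambda>x. x \<star>\<^bsub>B\<^esub> a"] by (auto simp: ract_add B.abelian_group_axioms)

lemma lact_zero_left [simp]: "x \<in> carrier B \<Longrightarrow> \<zero>\<^bsub>A\<^esub> \<odot>\<^bsub>B\<^esub> x = \<zero>\<^bsub>B\<^esub>"
  and lact_uminus_left: "\<lbrakk>a \<in> carrier A; x \<in> carrier B\<rbrakk> \<Longrightarrow> (\<ominus>\<^bsub>A\<^esub> a) \<odot>\<^bsub>B\<^esub> x = \<ominus>\<^bsub>B\<^esub> (a \<odot>\<^bsub>B\<^esub> x)"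
  and lact_minus_left: "\<lbrakk>a \<in> carrier A; b \<in> carrier A; x \<in> carrier B\<rbrakk> \<Longrightarrow>
    (a \<ominus>\<^bsub>A\<^esub> b) \<odot>\<^bsub>B\<^esub> x = (a \<odot>\<^bsub>B\<^esub> x) \<ominus>\<^bsub>B\<^esub> (b \<odot>\<^bsub>B\<^esub> x)"
  using additive_map[of A B "\<lambda>a. a \<odot>\<^bsub>B\<^esub> x"]
  by (auto simp: lact_add_left B.abelian_group_axioms A.abelian_group_axioms)

lemma bcomm_closed [simp, intro]: "\<lbrakk>a \<in> carrier A; x \<in> carrier B\<rbrakk> \<Longrightarrow> bcomm B x a \<in> carrier B"
  by (simp add: bcomm_def)

lemma bcomm_add:
  assumes "a \<in> carrier A" "x \<in> carrier B" "y \<in> carrier B"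
  shows "bcomm B (x \<oplus>\<^bsub>B\<^esub> y) a = bcomm B x a \<oplus>\<^bsub>B\<^esub> bcomm B y a"
proof -
  note [simp] = assms
  have c: "x \<star>\<^bsub>B\<^esub> a \<in> carrier B" "a \<odot>\<^bsub>B\<^esub> x \<in> carrier B" "y \<star>\<^bsub>B\<^esub> a \<in> carrier B" "a \<odot>\<^bsub>B\<^esub> y \<in> carrier B"
    by simp_all
  show ?thesis
    unfolding bcomm_def lact_add[OF assms] ract_add[OF assms] using c by algebra
qed

lemma bcomm_zero [simp]: "a \<in> carrier A \<Longrightarrow> bcomm B \<zero>\<^bsub>B\<^esub> a = \<zero>\<^bsub>B\<^esub>"
  and bcomm_uminus: "\<lbrakk>a \<in> carrier A; x \<in> carrier B\<rbrakk> \<Longrightarrow> bcomm B (\<ominus>\<^bsub>B\<^esub> x) a = \<ominus>\<^bsub>B\<^esub> bcomm B x a"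
  and bcomm_minus: "\<lbrakk>a \<in> carrier A; x \<in> carrier B; y \<in> carrier B\<rbrakk> \<Longrightarrow>
    bcomm B (x \<ominus>\<^bsub>B\<^esub> y) a = bcomm B x a \<ominus>\<^bsub>B\<^esub> bcomm B y a"
  using additive_map[of B B "\<lambda>x. bcomm B x a"] by (auto simp: bcomm_add B.abelian_group_axioms)

lemma bcomm_add_right:
  assumes "a \<in> carrier A" "b \<in> carrier A" "x \<in> carrier B"
  shows "bcomm B x (a \<oplus>\<^bsub>A\<^esub> b) = bcomm B x a \<oplus>\<^bsub>B\<^esub> bcomm B x b"
proof -
  note [simp] = assms
  have c: "x \<star>\<^bsub>B\<^esub> a \<in> carrier B" "a \<odot>\<^bsub>B\<^esub> x \<in> carrier B" "x \<star>\<^bsub>B\<^esub> b \<in> carrier B" "b \<odot>\<^bsub>B\<^esub> x \<in> carrier B"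
    by simp_all
  show ?thesis
    unfolding bcomm_def lact_add_left[OF assms] ract_add_right[OF assms] using c by algebra
qed

text \<open>\<open>[x,-]\<close> is a derivation of the algebra with values in the bimodule.\<close>

lemma bcomm_mult:
  assumes "a \<in> carrier A" "b \<in> carrier A" "x \<in> carrier B"
  shows "bcomm B x (a \<otimes>\<^bsub>A\<^esub> b) = (bcomm B x a \<star>\<^bsub>B\<^esub> b) \<oplus>\<^bsub>B\<^esub> (a \<odot>\<^bsub>B\<^esub> bcomm B x b)"
proof -
  note [simp] = assms
  have c: "x \<star>\<^bsub>B\<^esub> a \<star>\<^bsub>B\<^esub> b \<in> carrier B" "a \<odot>\<^bsub>B\<^esub> (x \<star>\<^bsub>B\<^esub> b) \<in> carrier B"
      "a \<odot>\<^bsub>B\<^esub> (b \<odot>\<^bsub>B\<^esub> x) \<in> carrier B"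
    by simp_all
  have "bcomm B x (a \<otimes>\<^bsub>A\<^esub> b) = x \<star>\<^bsub>B\<^esub> a \<star>\<^bsub>B\<^esub> b \<ominus>\<^bsub>B\<^esub> a \<odot>\<^bsub>B\<^esub> (b \<odot>\<^bsub>B\<^esub> x)"
    by (simp add: bcomm_def lact_mult ract_mult)
  also have "\<dots> = (x \<star>\<^bsub>B\<^esub> a \<star>\<^bsub>B\<^esub> b \<ominus>\<^bsub>B\<^esub> a \<odot>\<^bsub>B\<^esub> (x \<star>\<^bsub>B\<^esub> b))
      \<oplus>\<^bsub>B\<^esub> (a \<odot>\<^bsub>B\<^esub> (x \<star>\<^bsub>B\<^esub> b) \<ominus>\<^bsub>B\<^esub> a \<odot>\<^bsub>B\<^esub> (b \<odot>\<^bsub>B\<^esub> x))"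
    using c by algebra
  also have "\<dots> = (bcomm B x a \<star>\<^bsub>B\<^esub> b) \<oplus>\<^bsub>B\<^esub> (a \<odot>\<^bsub>B\<^esub> bcomm B x b)"
    by (simp add: bcomm_def lact_minus ract_minus lact_ract)
  finally show ?thesis .
qed

lemma bcomm_lact:
  assumes "a \<in> carrier A" "b \<in> carrier A" "x \<in> carrier B"
  shows "bcomm B (a \<odot>\<^bsub>B\<^esub> x) b = (a \<odot>\<^bsub>B\<^esub> bcomm B x b) \<oplus>\<^bsub>B\<^esub> ((a \<otimes>\<^bsub>A\<^esub> b \<ominus>\<^bsub>A\<^esub> b \<otimes>\<^bsub>A\<^esub> a) \<odot>\<^bsub>B\<^esub> x)"
proof -
  note [simp] = assms
  have c: "a \<odot>\<^bsub>B\<^esub> (x \<star>\<^bsub>B\<^esub> b) \<in> carrier B" "a \<odot>\<^bsub>B\<^esub> (b \<odot>\<^bsub>B\<^esub> x) \<in> carrier B" "b \<odot>\<^bsub>B\<^esub> (a \<odot>\<^bsub>B\<^esub> x) \<in> carrier B"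
    by simp_all
  have "bcomm B (a \<odot>\<^bsub>B\<^esub> x) b = a \<odot>\<^bsub>B\<^esub> (x \<star>\<^bsub>B\<^esub> b) \<ominus>\<^bsub>B\<^esub> b \<odot>\<^bsub>B\<^esub> (a \<odot>\<^bsub>B\<^esub> x)"
    by (simp add: bcomm_def lact_ract)
  also have "\<dots> = (a \<odot>\<^bsub>B\<^esub> (x \<star>\<^bsub>B\<^esub> b) \<ominus>\<^bsub>B\<^esub> a \<odot>\<^bsub>B\<^esub> (b \<odot>\<^bsub>B\<^esub> x))
      \<oplus>\<^bsub>B\<^esub> (a \<odot>\<^bsub>B\<^esub> (b \<odot>\<^bsub>B\<^esub> x) \<ominus>\<^bsub>B\<^esub> b \<odot>\<^bsub>B\<^esub> (a \<odot>\<^bsub>B\<^esub> x))"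
    using c by algebra
  also have "\<dots> = (a \<odot>\<^bsub>B\<^esub> bcomm B x b) \<oplus>\<^bsub>B\<^esub> ((a \<otimes>\<^bsub>A\<^esub> b \<ominus>\<^bsub>A\<^esub> b \<otimes>\<^bsub>A\<^esub> a) \<odot>\<^bsub>B\<^esub> x)"
    by (simp add: bcomm_def lact_minus lact_minus_left lact_mult)
  finally show ?thesis .
qed

lemma bcomm_eq_zero_iff:
  "\<lbrakk>a \<in> carrier A; x \<in> carrier B\<rbrakk> \<Longrightarrow> bcomm B x a = \<zero>\<^bsub>B\<^esub> \<longleftrightarrow> x \<star>\<^bsub>B\<^esub> a = a \<odot>\<^bsub>B\<^esub> x"
  by (simp add: bcomm_def B.minus_eq_zero_iff)

end

lemma bimodule_imp_bimod: "bimodule A B \<Longrightarrow> bimod A B"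
  by (simp add: bimod_def bimod_axioms_def bimodule_def)

section \<open>Differential calculi and their 2-forms\<close>

locale first_order_setting =
  fixes K :: "('m, 'a, 'w) calculus"
  assumes first_order: "first_order_calculus K"
begin

sublocale W: bimod "alg K" "forms1 K"
  using first_order by (intro bimodule_imp_bimod) (simp add: first_order_calculus_def)

lemma dd_closed [simp]: "a \<in> carrier (alg K) \<Longrightarrow> dd K a \<in> carrier (forms1 K)"
  using first_order by (simp add: first_order_calculus_def)

lemma dd_add: "\<lbrakk>a \<in> carrier (alg K); b \<in> carrier (alg K)\<rbrakk> \<Longrightarrow>
    dd K (a \<oplus>\<^bsub>alg K\<^esub> b) = dd K a \<oplus>\<^bsub>forms1 K\<^esub> dd K b"
  and dd_mult: "\<lbrakk>a \<in> carrier (alg K); b \<in> carrier (alg K)\<rbrakk> \<Longrightarrow>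
    dd K (a \<otimes>\<^bsub>alg K\<^esub> b) = (dd K a \<star>\<^bsub>forms1 K\<^esub> b) \<oplus>\<^bsub>forms1 K\<^esub> (a \<odot>\<^bsub>forms1 K\<^esub> dd K b)"
  using first_order by (simp_all add: first_order_calculus_def)

text \<open>Negatives need no case of their own, since \<open>-(a db) = (-a) db\<close>.\<close>

lemma forms1_generated [consumes 1, case_names adb add]:
  assumes "x \<in> carrier (forms1 K)"
    and adb: "\<And>a b. \<lbrakk>a \<in> carrier (alg K); b \<in> carrier (alg K)\<rbrakk> \<Longrightarrow> P (a \<odot>\<^bsub>forms1 K\<^esub> dd K b)"
    and add: "\<And>x y. \<lbrakk>x \<in> carrier (forms1 K); y \<in> carrier (forms1 K); P x; P y\<rbrakk> \<Longrightarrow> P (x \<oplus>\<^bsub>forms1 K\<^esub> y)"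
  shows "P x"
proof -
  let ?G = "{a \<odot>\<^bsub>forms1 K\<^esub> dd K b | a b. a \<in> carrier (alg K) \<and> b \<in> carrier (alg K)}"
  have "x \<in> generate (add_monoid (forms1 K)) ?G"
    using first_order \<open>x \<in> carrier (forms1 K)\<close> by (simp add: first_order_calculus_def)
  then have "x \<in> carrier (forms1 K) \<and> P x"
  proof induction
    case one
    then show ?case
      using adb[of "\<zero>\<^bsub>alg K\<^esub>" "\<zero>\<^bsub>alg K\<^esub>"] by simp
  next
    case (incl h)
    then show ?case by (auto simp: adb)
  next
    case (inv h)
    then obtain a b where ab: "a \<in> carrier (alg K)" "b \<in> carrier (alg K)"
      and h: "h = a \<odot>\<^bsub>forms1 K\<^esub> dd K b"
      by auto
    have "m_inv (add_monoid (forms1 K)) h = (\<ominus>\<^bsub>alg K\<^esub> a) \<odot>\<^bsub>forms1 K\<^esub> dd K b"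
      using ab by (simp add: h W.lact_uminus_left a_inv_def[symmetric])
    then show ?case
      using ab adb[of "\<ominus>\<^bsub>alg K\<^esub> a" b] by simp
  next
    case (eng x y)
    then show ?case by (simp add: add)
  qed
  then show ?thesis ..
qed

lemma dd_one [simp]: "dd K \<one>\<^bsub>alg K\<^esub> = \<zero>\<^bsub>forms1 K\<^esub>"
  using dd_mult[of "\<one>\<^bsub>alg K\<^esub>" "\<one>\<^bsub>alg K\<^esub>"]
    W.B.add.l_cancel_one'[of "dd K \<one>\<^bsub>alg K\<^esub>" "dd K \<one>\<^bsub>alg K\<^esub>"] by simp

end

locale two_form_setting = first_order_setting K
  for K :: "('m, 'a, 'w) calculus" +
  fixes F :: "('a, 'w, 'e) two_forms"
  assumes extension: "two_form_extension K F"
begin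

sublocale E: bimod "alg K" F
  using extension by (intro bimodule_imp_bimod) (simp add: two_form_extension_def)

lemma dif_closed [simp]: "x \<in> carrier (forms1 K) \<Longrightarrow> dif F x \<in> carrier F"
  and wedge_closed [simp]: "\<lbrakk>x \<in> carrier (forms1 K); y \<in> carrier (forms1 K)\<rbrakk> \<Longrightarrow> x \<diamondop>\<^bsub>F\<^esub> y \<in> carrier F"
  using extension unfolding two_form_extension_def by blast+

lemma dif_add: "\<lbrakk>x \<in> carrier (forms1 K); y \<in> carrier (forms1 K)\<rbrakk> \<Longrightarrow>
    dif F (x \<oplus>\<^bsub>forms1 K\<^esub> y) = dif F x \<oplus>\<^bsub>F\<^esub> dif F y"
  and wedge_add_left: "\<lbrakk>x \<in> carrier (forms1 K); y \<in> carrier (forms1 K); z \<in> carrier (forms1 K)\<rbrakk> \<Longrightarrow>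
    (x \<oplus>\<^bsub>forms1 K\<^esub> y) \<diamondop>\<^bsub>F\<^esub> z = (x \<diamondop>\<^bsub>F\<^esub> z) \<oplus>\<^bsub>F\<^esub> (y \<diamondop>\<^bsub>F\<^esub> z)"
  and wedge_add_right: "\<lbrakk>x \<in> carrier (forms1 K); y \<in> carrier (forms1 K); z \<in> carrier (forms1 K)\<rbrakk> \<Longrightarrow>
    x \<diamondop>\<^bsub>F\<^esub> (y \<oplus>\<^bsub>forms1 K\<^esub> z) = (x \<diamondop>\<^bsub>F\<^esub> y) \<oplus>\<^bsub>F\<^esub> (x \<diamondop>\<^bsub>F\<^esub> z)"
  and wedge_lact: "\<lbrakk>a \<in> carrier (alg K); x \<in> carrier (forms1 K); y \<in> carrier (forms1 K)\<rbrakk> \<Longrightarrow>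
    (a \<odot>\<^bsub>forms1 K\<^esub> x) \<diamondop>\<^bsub>F\<^esub> y = a \<odot>\<^bsub>F\<^esub> (x \<diamondop>\<^bsub>F\<^esub> y)"
  and wedge_balanced: "\<lbrakk>a \<in> carrier (alg K); x \<in> carrier (forms1 K); y \<in> carrier (forms1 K)\<rbrakk> \<Longrightarrow>
    (x \<star>\<^bsub>forms1 K\<^esub> a) \<diamondop>\<^bsub>F\<^esub> y = x \<diamondop>\<^bsub>F\<^esub> (a \<odot>\<^bsub>forms1 K\<^esub> y)"
  and wedge_ract: "\<lbrakk>a \<in> carrier (alg K); x \<in> carrier (forms1 K); y \<in> carrier (forms1 K)\<rbrakk> \<Longrightarrow>
    x \<diamondop>\<^bsub>F\<^esub> (y \<star>\<^bsub>forms1 K\<^esub> a) = (x \<diamondop>\<^bsub>F\<^esub> y) \<star>\<^bsub>F\<^esub> a"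
  and dif_lact: "\<lbrakk>a \<in> carrier (alg K); x \<in> carrier (forms1 K)\<rbrakk> \<Longrightarrow>
    dif F (a \<odot>\<^bsub>forms1 K\<^esub> x) = (dd K a \<diamondop>\<^bsub>F\<^esub> x) \<oplus>\<^bsub>F\<^esub> (a \<odot>\<^bsub>F\<^esub> dif F x)"
  and dif_ract: "\<lbrakk>a \<in> carrier (alg K); x \<in> carrier (forms1 K)\<rbrakk> \<Longrightarrow>
    dif F (x \<star>\<^bsub>forms1 K\<^esub> a) = (dif F x \<star>\<^bsub>F\<^esub> a) \<ominus>\<^bsub>F\<^esub> (x \<diamondop>\<^bsub>F\<^esub> dd K a)"
  and dif_dd [simp]: "a \<in> carrier (alg K) \<Longrightarrow> dif F (dd K a) = \<zero>\<^bsub>F\<^esub>"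
  using extension unfolding two_form_extension_def by blast+

lemma dif_zero [simp]: "dif F \<zero>\<^bsub>forms1 K\<^esub> = \<zero>\<^bsub>F\<^esub>"
  and dif_uminus: "x \<in> carrier (forms1 K) \<Longrightarrow> dif F (\<ominus>\<^bsub>forms1 K\<^esub> x) = \<ominus>\<^bsub>F\<^esub> dif F x"
  and dif_minus: "\<lbrakk>x \<in> carrier (forms1 K); y \<in> carrier (forms1 K)\<rbrakk> \<Longrightarrow>
    dif F (x \<ominus>\<^bsub>forms1 K\<^esub> y) = dif F x \<ominus>\<^bsub>F\<^esub> dif F y"
  using additive_map[of "forms1 K" F "dif F"]
  by (auto simp: dif_add E.B.abelian_group_axioms W.B.abelian_group_axioms)

lemma wedge_zero_left [simp]: "x \<in> carrier (forms1 K) \<Longrightarrow> \<zero>\<^bsub>forms1 K\<^esub> \<diamondop>\<^bsub>F\<^esub> x = \<zero>\<^bsub>F\<^esub>"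
  and wedge_uminus_left: "\<lbrakk>x \<in> carrier (forms1 K); y \<in> carrier (forms1 K)\<rbrakk> \<Longrightarrow>
    (\<ominus>\<^bsub>forms1 K\<^esub> x) \<diamondop>\<^bsub>F\<^esub> y = \<ominus>\<^bsub>F\<^esub> (x \<diamondop>\<^bsub>F\<^esub> y)"
  using additive_map[of "forms1 K" F "\<lambda>z. z \<diamondop>\<^bsub>F\<^esub> x"] additive_map[of "forms1 K" F "\<lambda>z. z \<diamondop>\<^bsub>F\<^esub> y"]
  by (auto simp: wedge_add_left E.B.abelian_group_axioms W.B.abelian_group_axioms)

lemma wedge_zero_right [simp]: "x \<in> carrier (forms1 K) \<Longrightarrow> x \<diamondop>\<^bsub>F\<^esub> \<zero>\<^bsub>forms1 K\<^esub> = \<zero>\<^bsub>F\<^esub>"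
  and wedge_uminus_right: "\<lbrakk>x \<in> carrier (forms1 K); y \<in> carrier (forms1 K)\<rbrakk> \<Longrightarrow>
    x \<diamondop>\<^bsub>F\<^esub> (\<ominus>\<^bsub>forms1 K\<^esub> y) = \<ominus>\<^bsub>F\<^esub> (x \<diamondop>\<^bsub>F\<^esub> y)"
  using additive_map[of "forms1 K" F "\<lambda>z. x \<diamondop>\<^bsub>F\<^esub> z"]
  by (auto simp: wedge_add_right E.B.abelian_group_axioms W.B.abelian_group_axioms)

lemma anti_closed [simp]: "\<lbrakk>x \<in> carrier (forms1 K); y \<in> carrier (forms1 K)\<rbrakk> \<Longrightarrow> anti F x y \<in> carrier F"
  by (simp add: anti_def)

lemma anti_comm: "\<lbrakk>x \<in> carrier (forms1 K); y \<in> carrier (forms1 K)\<rbrakk> \<Longrightarrow> anti F x y = anti F y x"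
  by (simp add: anti_def E.B.a_comm)

lemma anti_add_left: "\<lbrakk>x \<in> carrier (forms1 K); y \<in> carrier (forms1 K); z \<in> carrier (forms1 K)\<rbrakk> \<Longrightarrow>
    anti F (x \<oplus>\<^bsub>forms1 K\<^esub> y) z = anti F x z \<oplus>\<^bsub>F\<^esub> anti F y z"
  by (simp add: anti_def wedge_add_left wedge_add_right E.B.a_ac)

lemma anti_zero_left [simp]: "x \<in> carrier (forms1 K) \<Longrightarrow> anti F \<zero>\<^bsub>forms1 K\<^esub> x = \<zero>\<^bsub>F\<^esub>"
  and anti_uminus_left: "\<lbrakk>x \<in> carrier (forms1 K); y \<in> carrier (forms1 K)\<rbrakk> \<Longrightarrow>
    anti F (\<ominus>\<^bsub>forms1 K\<^esub> x) y = \<ominus>\<^bsub>F\<^esub> anti F x y"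
  by (simp_all add: anti_def wedge_uminus_left wedge_uminus_right E.B.minus_add)

lemma anti_minus_left: "\<lbrakk>x \<in> carrier (forms1 K); y \<in> carrier (forms1 K); z \<in> carrier (forms1 K)\<rbrakk> \<Longrightarrow>
    anti F (x \<ominus>\<^bsub>forms1 K\<^esub> y) z = anti F x z \<ominus>\<^bsub>F\<^esub> anti F y z"
  by (simp add: W.B.minus_eq E.B.minus_eq anti_add_left anti_uminus_left)

text \<open>
  The terms \<open>x da\<close> and \<open>da x\<close> come from \<open>d(xa)\<close> and \<open>d(ax)\<close> and enter with the same sign: a
  commutator in degree 0 turns into an anticommutator in degree 1.
\<close>

lemma dif_bcomm:
  assumes "a \<in> carrier (alg K)" "x \<in> carrier (forms1 K)"
  shows "dif F (bcomm (forms1 K) x a) = bcomm F (dif F x) a \<ominus>\<^bsub>F\<^esub> anti F x (dd K a)"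
proof -
  have c: "dif F x \<star>\<^bsub>F\<^esub> a \<in> carrier F" "a \<odot>\<^bsub>F\<^esub> dif F x \<in> carrier F"
    "x \<diamondop>\<^bsub>F\<^esub> dd K a \<in> carrier F" "dd K a \<diamondop>\<^bsub>F\<^esub> x \<in> carrier F"
    using assms by simp_all
  have "dif F (bcomm (forms1 K) x a)
      = dif F x \<star>\<^bsub>F\<^esub> a \<ominus>\<^bsub>F\<^esub> x \<diamondop>\<^bsub>F\<^esub> dd K a \<ominus>\<^bsub>F\<^esub> (dd K a \<diamondop>\<^bsub>F\<^esub> x \<oplus>\<^bsub>F\<^esub> a \<odot>\<^bsub>F\<^esub> dif F x)"
    using assms by (simp add: bcomm_def dif_minus dif_ract dif_lact)
  also have "\<dots> = bcomm F (dif F x) a \<ominus>\<^bsub>F\<^esub> anti F x (dd K a)"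
    unfolding bcomm_def anti_def using c by algebra
  finally show ?thesis .
qed

text \<open>
  Here \<open>y(ax) = (ya)x = a(yx) + [y,a]x\<close>.  With \<open>dif_bcomm\<close> this is how relations in degree 1 produce
  relations in degree 2.
\<close>

lemma anti_lact:
  assumes "a \<in> carrier (alg K)" "x \<in> carrier (forms1 K)" "y \<in> carrier (forms1 K)"
  shows "anti F (a \<odot>\<^bsub>forms1 K\<^esub> x) y
    = (a \<odot>\<^bsub>F\<^esub> anti F x y) \<oplus>\<^bsub>F\<^esub> (bcomm (forms1 K) y a \<diamondop>\<^bsub>F\<^esub> x)"
proof -
  have c: "a \<odot>\<^bsub>F\<^esub> (x \<diamondop>\<^bsub>F\<^esub> y) \<in> carrier F" "a \<odot>\<^bsub>F\<^esub> (y \<diamondop>\<^bsub>F\<^esub> x) \<in> carrier F"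
    "(y \<star>\<^bsub>forms1 K\<^esub> a) \<diamondop>\<^bsub>F\<^esub> x \<in> carrier F"
    using assms by simp_all
  have "bcomm (forms1 K) y a \<diamondop>\<^bsub>F\<^esub> x = (y \<star>\<^bsub>forms1 K\<^esub> a) \<diamondop>\<^bsub>F\<^esub> x \<ominus>\<^bsub>F\<^esub> a \<odot>\<^bsub>F\<^esub> (y \<diamondop>\<^bsub>F\<^esub> x)"
    using assms by (simp add: bcomm_def W.B.minus_eq E.B.minus_eq wedge_add_left wedge_uminus_left
        wedge_lact)
  moreover have "anti F (a \<odot>\<^bsub>forms1 K\<^esub> x) y = a \<odot>\<^bsub>F\<^esub> (x \<diamondop>\<^bsub>F\<^esub> y) \<oplus>\<^bsub>F\<^esub> (y \<star>\<^bsub>forms1 K\<^esub> a) \<diamondop>\<^bsub>F\<^esub> x"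
    using assms by (simp add: anti_def wedge_lact wedge_balanced)
  moreover have "a \<odot>\<^bsub>F\<^esub> anti F x y = a \<odot>\<^bsub>F\<^esub> (x \<diamondop>\<^bsub>F\<^esub> y) \<oplus>\<^bsub>F\<^esub> a \<odot>\<^bsub>F\<^esub> (y \<diamondop>\<^bsub>F\<^esub> x)"
    using assms by (simp add: anti_def E.lact_add)
  ultimately show ?thesis
    using c by (simp only:) algebra
qed

lemma bcomm_wedge:
  assumes "a \<in> carrier (alg K)" "x \<in> carrier (forms1 K)" "y \<in> carrier (forms1 K)"
  shows "bcomm F (x \<diamondop>\<^bsub>F\<^esub> y) a = (x \<diamondop>\<^bsub>F\<^esub> bcomm (forms1 K) y a) \<oplus>\<^bsub>F\<^esub> (bcomm (forms1 K) x a \<diamondop>\<^bsub>F\<^esub> y)"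
proof -
  have c: "(x \<diamondop>\<^bsub>F\<^esub> y) \<star>\<^bsub>F\<^esub> a \<in> carrier F" "a \<odot>\<^bsub>F\<^esub> (x \<diamondop>\<^bsub>F\<^esub> y) \<in> carrier F"
    "x \<diamondop>\<^bsub>F\<^esub> (a \<odot>\<^bsub>forms1 K\<^esub> y) \<in> carrier F"
    using assms by simp_all
  have "x \<diamondop>\<^bsub>F\<^esub> bcomm (forms1 K) y a = (x \<diamondop>\<^bsub>F\<^esub> y) \<star>\<^bsub>F\<^esub> a \<ominus>\<^bsub>F\<^esub> x \<diamondop>\<^bsub>F\<^esub> (a \<odot>\<^bsub>forms1 K\<^esub> y)"
    using assms by (simp add: bcomm_def W.B.minus_eq E.B.minus_eq wedge_add_right wedge_uminus_right
        wedge_ract)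
  moreover have "bcomm (forms1 K) x a \<diamondop>\<^bsub>F\<^esub> y = x \<diamondop>\<^bsub>F\<^esub> (a \<odot>\<^bsub>forms1 K\<^esub> y) \<ominus>\<^bsub>F\<^esub> a \<odot>\<^bsub>F\<^esub> (x \<diamondop>\<^bsub>F\<^esub> y)"
    using assms by (simp add: bcomm_def W.B.minus_eq E.B.minus_eq wedge_add_left wedge_uminus_left
        wedge_lact wedge_balanced)
  ultimately show ?thesis
    unfolding bcomm_def[of F] using c by (simp only:) algebra
qed

end

section \<open>The maximal prolongation modulo relations\<close>

context first_order_setting
begin

text \<open>
  A list of pairs of 1-forms stands for the sum of their products, and a list of pairs \<open>(a,b)\<close> in
  the algebra for the 1-form \<open>\<Sum> a db\<close>.  Lists are added by concatenation.
\<close>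

definition formal_products :: "('w \<times> 'w) list set" where
  "formal_products = lists (carrier (forms1 K) \<times> carrier (forms1 K))"

definition formal_exact_terms :: "('a \<times> 'a) list set" where
  "formal_exact_terms = lists (carrier (alg K) \<times> carrier (alg K))"

lemma formal_products_simps [simp]:
  "[] \<in> formal_products"
  "(x, y) # u \<in> formal_products \<longleftrightarrow> x \<in> carrier (forms1 K) \<and> y \<in> carrier (forms1 K) \<and> u \<in> formal_products"
  "u @ v \<in> formal_products \<longleftrightarrow> u \<in> formal_products \<and> v \<in> formal_products"
  by (auto simp: formal_products_def)

lemma formal_exact_terms_simps [simp]:
  "[] \<in> formal_exact_terms"
  "(a, b) # r \<in> formal_exact_terms \<longleftrightarrow> a \<in> carrier (alg K) \<and> b \<in> carrier (alg K) \<and> r \<in> formal_exact_terms"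
  "r @ r' \<in> formal_exact_terms \<longleftrightarrow> r \<in> formal_exact_terms \<and> r' \<in> formal_exact_terms"
  by (auto simp: formal_exact_terms_def)

lemma formal_products_induct [consumes 1, case_names Nil Cons]:
  assumes "u \<in> formal_products" "P []"
    and "\<And>x y u. \<lbrakk>x \<in> carrier (forms1 K); y \<in> carrier (forms1 K); u \<in> formal_products; P u\<rbrakk> \<Longrightarrow>
      P ((x, y) # u)"
  shows "P u"
  using assms(1) by (induction u) (use assms(2,3) in \<open>auto simp: formal_products_def\<close>)

lemma formal_exact_terms_induct [consumes 1, case_names Nil Cons]:
  assumes "r \<in> formal_exact_terms" "P []"
    and "\<And>a b r. \<lbrakk>a \<in> carrier (alg K); b \<in> carrier (alg K); r \<in> formal_exact_terms; P r\<rbrakk> \<Longrightarrow>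
      P ((a, b) # r)"
  shows "P r"
  using assms(1) by (induction r) (use assms(2,3) in \<open>auto simp: formal_exact_terms_def\<close>)

definition fneg :: "('w \<times> 'w) list \<Rightarrow> ('w \<times> 'w) list" where
  "fneg u = map (\<lambda>(x, y). (\<ominus>\<^bsub>forms1 K\<^esub> x, y)) u"

definition flact :: "'a \<Rightarrow> ('w \<times> 'w) list \<Rightarrow> ('w \<times> 'w) list" where
  "flact a u = map (\<lambda>(x, y). (a \<odot>\<^bsub>forms1 K\<^esub> x, y)) u"

definition fract :: "('w \<times> 'w) list \<Rightarrow> 'a \<Rightarrow> ('w \<times> 'w) list" where
  "fract u a = map (\<lambda>(x, y). (x, y \<star>\<^bsub>forms1 K\<^esub> a)) u"

definition fdd :: "('a \<times> 'a) list \<Rightarrow> ('w \<times> 'w) list" where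
  "fdd r = map (\<lambda>(a, b). (dd K a, dd K b)) r"

definition sum_adb :: "('a \<times> 'a) list \<Rightarrow> 'w" where
  "sum_adb r = foldr (\<lambda>(a, b) z. (a \<odot>\<^bsub>forms1 K\<^esub> dd K b) \<oplus>\<^bsub>forms1 K\<^esub> z) r \<zero>\<^bsub>forms1 K\<^esub>"

lemma formal_simps [simp]:
  "fneg [] = []" "fneg ((x, y) # u) = (\<ominus>\<^bsub>forms1 K\<^esub> x, y) # fneg u" "fneg (u @ v) = fneg u @ fneg v"
  "flact a [] = []" "flact a ((x, y) # u) = (a \<odot>\<^bsub>forms1 K\<^esub> x, y) # flact a u"
  "flact a (u @ v) = flact a u @ flact a v"
  "fract [] a = []" "fract ((x, y) # u) a = (x, y \<star>\<^bsub>forms1 K\<^esub> a) # fract u a"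
  "fract (u @ v) a = fract u a @ fract v a"
  "fdd [] = []" "fdd ((a, b) # r) = (dd K a, dd K b) # fdd r" "fdd (r @ r') = fdd r @ fdd r'"
  "sum_adb [] = \<zero>\<^bsub>forms1 K\<^esub>"
  "sum_adb ((a, b) # r) = (a \<odot>\<^bsub>forms1 K\<^esub> dd K b) \<oplus>\<^bsub>forms1 K\<^esub> sum_adb r"
  by (simp_all add: fneg_def flact_def fract_def fdd_def sum_adb_def)

lemma fneg_closed [simp]: "u \<in> formal_products \<Longrightarrow> fneg u \<in> formal_products"
  by (induction rule: formal_products_induct) simp_all

lemma flact_closed [simp]: "\<lbrakk>u \<in> formal_products; a \<in> carrier (alg K)\<rbrakk> \<Longrightarrow> flact a u \<in> formal_products"
  by (induction rule: formal_products_induct) simp_all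

lemma fract_closed [simp]: "\<lbrakk>u \<in> formal_products; a \<in> carrier (alg K)\<rbrakk> \<Longrightarrow> fract u a \<in> formal_products"
  by (induction rule: formal_products_induct) simp_all

lemma fdd_closed [simp]: "r \<in> formal_exact_terms \<Longrightarrow> fdd r \<in> formal_products"
  by (induction rule: formal_exact_terms_induct) simp_all

lemma sum_adb_closed [simp]: "r \<in> formal_exact_terms \<Longrightarrow> sum_adb r \<in> carrier (forms1 K)"
  by (induction rule: formal_exact_terms_induct) simp_all

lemma sum_adb_append: "\<lbrakk>r \<in> formal_exact_terms; r' \<in> formal_exact_terms\<rbrakk> \<Longrightarrow>
    sum_adb (r @ r') = sum_adb r \<oplus>\<^bsub>forms1 K\<^esub> sum_adb r'"
  by (induction rule: formal_exact_terms_induct) (simp_all add: W.B.a_assoc)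

lemma sum_adb_surj:
  assumes "x \<in> carrier (forms1 K)"
  shows "\<exists>r \<in> formal_exact_terms. sum_adb r = x"
  using assms
proof (induction rule: forms1_generated)
  case (adb a b)
  then show ?case by (intro bexI[of _ "[(a, b)]"]) simp_all
next
  case (add x y)
  then obtain r r' where "r \<in> formal_exact_terms" "sum_adb r = x"
    "r' \<in> formal_exact_terms" "sum_adb r' = y"
    by blast
  then show ?case
    by (intro bexI[of _ "r @ r'"]) (simp_all add: sum_adb_append)
qed

text \<open>
  A formal representative of \<open>dx\<close>.  The choice of \<open>r\<close> is immaterial modulo any of the congruences
  below, by their clause \<open>prolong\<close>.
\<close>

definition fdif :: "'w \<Rightarrow> ('w \<times> 'w) list" where
  "fdif x = fdd (SOME r. r \<in> formal_exact_terms \<and> sum_adb r = x)"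

lemma fdifE:
  assumes "x \<in> carrier (forms1 K)"
  obtains r where "r \<in> formal_exact_terms" "sum_adb r = x" "fdif x = fdd r"
proof -
  have "\<exists>r. r \<in> formal_exact_terms \<and> sum_adb r = x"
    using sum_adb_surj[OF assms] by blast
  from someI_ex[OF this] that show thesis
    unfolding fdif_def by blast
qed

lemma fdif_closed [simp]: "x \<in> carrier (forms1 K) \<Longrightarrow> fdif x \<in> formal_products"
  by (erule fdifE) simp

text \<open>
  The congruence that presents the maximal prolongation with the further relations \<open>R\<close>.  The
  clause \<open>prolong\<close> makes \<open>d(\<Sum> a db) = \<Sum> da db\<close> well defined.  The clause \<open>left_zero\<close> turns the monoid
  of lists into a group: with \<open>left_add\<close> it makes \<open>(-x) y\<close> the negative of \<open>x y\<close>.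
\<close>

inductive prolongation_rel :: "(('w \<times> 'w) list \<times> ('w \<times> 'w) list) set \<Rightarrow>
    ('w \<times> 'w) list \<Rightarrow> ('w \<times> 'w) list \<Rightarrow> bool" for R where
  base: "\<lbrakk>(u, v) \<in> R; u \<in> formal_products; v \<in> formal_products\<rbrakk> \<Longrightarrow> prolongation_rel R u v"
| prolong: "\<lbrakk>r \<in> formal_exact_terms; r' \<in> formal_exact_terms; sum_adb r = sum_adb r'\<rbrakk> \<Longrightarrow>
    prolongation_rel R (fdd r) (fdd r')"
| balanced: "\<lbrakk>a \<in> carrier (alg K); x \<in> carrier (forms1 K); y \<in> carrier (forms1 K)\<rbrakk> \<Longrightarrow>
    prolongation_rel R [(x \<star>\<^bsub>forms1 K\<^esub> a, y)] [(x, a \<odot>\<^bsub>forms1 K\<^esub> y)]"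
| left_add: "\<lbrakk>x \<in> carrier (forms1 K); x' \<in> carrier (forms1 K); y \<in> carrier (forms1 K)\<rbrakk> \<Longrightarrow>
    prolongation_rel R [(x \<oplus>\<^bsub>forms1 K\<^esub> x', y)] [(x, y), (x', y)]"
| right_add: "\<lbrakk>x \<in> carrier (forms1 K); y \<in> carrier (forms1 K); y' \<in> carrier (forms1 K)\<rbrakk> \<Longrightarrow>
    prolongation_rel R [(x, y \<oplus>\<^bsub>forms1 K\<^esub> y')] [(x, y), (x, y')]"
| left_zero: "y \<in> carrier (forms1 K) \<Longrightarrow> prolongation_rel R [(\<zero>\<^bsub>forms1 K\<^esub>, y)] []"
| swap: "\<lbrakk>u \<in> formal_products; v \<in> formal_products\<rbrakk> \<Longrightarrow> prolongation_rel R (u @ v) (v @ u)"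
| refl: "u \<in> formal_products \<Longrightarrow> prolongation_rel R u u"
| sym: "prolongation_rel R u v \<Longrightarrow> prolongation_rel R v u"
| trans: "\<lbrakk>prolongation_rel R u v; prolongation_rel R v w\<rbrakk> \<Longrightarrow> prolongation_rel R u w"
| append: "\<lbrakk>prolongation_rel R u v; prolongation_rel R u' v'\<rbrakk> \<Longrightarrow> prolongation_rel R (u @ u') (v @ v')"
| lact: "\<lbrakk>a \<in> carrier (alg K); prolongation_rel R u v\<rbrakk> \<Longrightarrow> prolongation_rel R (flact a u) (flact a v)"
| ract: "\<lbrakk>a \<in> carrier (alg K); prolongation_rel R u v\<rbrakk> \<Longrightarrow> prolongation_rel R (fract u a) (fract v a)"

lemma prolongation_rel_closed:
  "prolongation_rel R u v \<Longrightarrow> u \<in> formal_products \<and> v \<in> formal_products"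
  by (induction rule: prolongation_rel.induct) auto

definition form_class :: "(('w \<times> 'w) list \<times> ('w \<times> 'w) list) set \<Rightarrow>
    ('w \<times> 'w) list \<Rightarrow> ('w \<times> 'w) list set" where
  "form_class R u = {v. prolongation_rel R u v}"

lemma class_eq_iff: "u \<in> formal_products \<Longrightarrow>
    form_class R u = form_class R v \<longleftrightarrow> prolongation_rel R u v"
  unfolding form_class_def
  by (blast intro: prolongation_rel.sym prolongation_rel.trans prolongation_rel.refl)

text \<open>
  The operations are unions over all representatives; as the relation is a congruence, each of
  these unions is a single class.
\<close>

definition prolongation :: "(('w \<times> 'w) list \<times> ('w \<times> 'w) list) set \<Rightarrow>
    ('a, 'w, ('w \<times> 'w) list set) two_forms" where
  "prolongation R = \<lparr>carrier = form_class R ` formal_products, mult = undefined, one = undefined,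
     zero = form_class R [],
     add = (\<lambda>X Y. \<Union>u\<in>X. \<Union>v\<in>Y. form_class R (u @ v)),
     smult = (\<lambda>a X. \<Union>u\<in>X. form_class R (flact a u)),
     rsmult = (\<lambda>X a. \<Union>u\<in>X. form_class R (fract u a)),
     wedge = (\<lambda>x y. form_class R [(x, y)]),
     dif = (\<lambda>x. form_class R (fdif x))\<rparr>"

context
  fixes R :: "(('w \<times> 'w) list \<times> ('w \<times> 'w) list) set"
begin

abbreviation (input) "E \<equiv> prolongation R"

lemma prolongation_simps:
  "carrier E = form_class R ` formal_products" "\<zero>\<^bsub>E\<^esub> = form_class R []"
  "x \<diamondop>\<^bsub>E\<^esub> y = form_class R [(x, y)]" "dif E x = form_class R (fdif x)"
  by (simp_all add: prolongation_def)

lemma class_closed [simp]: "u \<in> formal_products \<Longrightarrow> form_class R u \<in> carrier E"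
  by (simp add: prolongation_simps)

lemma class_cases:
  assumes "X \<in> carrier E"
  obtains u where "u \<in> formal_products" "X = form_class R u"
  using assms by (auto simp: prolongation_simps)

lemma class_add:
  assumes "u \<in> formal_products" "v \<in> formal_products"
  shows "form_class R u \<oplus>\<^bsub>E\<^esub> form_class R v = form_class R (u @ v)"
proof -
  have "form_class R (u' @ v') = form_class R (u @ v)"
    if "u' \<in> form_class R u" "v' \<in> form_class R v" for u' v'
  proof -
    have "prolongation_rel R (u @ v) (u' @ v')"
      using that by (simp add: form_class_def prolongation_rel.append)
    then show ?thesis
      using assms class_eq_iff[of "u @ v" R "u' @ v'"] by simp
  qed
  moreover have "u \<in> form_class R u" "v \<in> form_class R v"
    using assms by (simp_all add: form_class_def prolongation_rel.refl)
  moreover have "form_class R u \<oplus>\<^bsub>E\<^esub> form_class R v =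
      (\<Union>u'\<in>form_class R u. \<Union>v'\<in>form_class R v. form_class R (u' @ v'))"
    by (simp add: prolongation_def)
  ultimately show ?thesis
    by blast
qed

lemma class_lact:
  assumes "a \<in> carrier (alg K)" "u \<in> formal_products"
  shows "a \<odot>\<^bsub>E\<^esub> form_class R u = form_class R (flact a u)"
proof -
  have "form_class R (flact a u') = form_class R (flact a u)" if "u' \<in> form_class R u" for u'
  proof -
    have "prolongation_rel R (flact a u) (flact a u')"
      using that assms by (simp add: form_class_def prolongation_rel.lact)
    then show ?thesis
      using assms class_eq_iff[of "flact a u" R "flact a u'"] by simp
  qed
  moreover have "u \<in> form_class R u"
    using assms by (simp add: form_class_def prolongation_rel.refl)
  moreover have "a \<odot>\<^bsub>E\<^esub> form_class R u = (\<Union>u'\<in>form_class R u. form_class R (flact a u'))"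
    by (simp add: prolongation_def)
  ultimately show ?thesis
    by blast
qed

lemma class_ract:
  assumes "a \<in> carrier (alg K)" "u \<in> formal_products"
  shows "form_class R u \<star>\<^bsub>E\<^esub> a = form_class R (fract u a)"
proof -
  have "form_class R (fract u' a) = form_class R (fract u a)" if "u' \<in> form_class R u" for u'
  proof -
    have "prolongation_rel R (fract u a) (fract u' a)"
      using that assms by (simp add: form_class_def prolongation_rel.ract)
    then show ?thesis
      using assms class_eq_iff[of "fract u a" R "fract u' a"] by simp
  qed
  moreover have "u \<in> form_class R u"
    using assms by (simp add: form_class_def prolongation_rel.refl)
  moreover have "form_class R u \<star>\<^bsub>E\<^esub> a = (\<Union>u'\<in>form_class R u. form_class R (fract u' a))"
    by (simp add: prolongation_def)
  ultimately show ?thesis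
    by blast
qed

lemma class_Cons: "\<lbrakk>x \<in> carrier (forms1 K); y \<in> carrier (forms1 K); u \<in> formal_products\<rbrakk> \<Longrightarrow>
    form_class R ((x, y) # u) = (x \<diamondop>\<^bsub>E\<^esub> y) \<oplus>\<^bsub>E\<^esub> form_class R u"
  by (simp add: prolongation_simps(3) class_add)

lemma prolongation_wedge_closed [simp]:
  "\<lbrakk>x \<in> carrier (forms1 K); y \<in> carrier (forms1 K)\<rbrakk> \<Longrightarrow> x \<diamondop>\<^bsub>E\<^esub> y \<in> carrier E"
  by (simp add: prolongation_simps(3))

lemma prolongation_abelian_monoid: "abelian_monoid E"
proof (rule abelian_monoidI)
  fix X Y assume "X \<in> carrier E" "Y \<in> carrier E"
  then show "X \<oplus>\<^bsub>E\<^esub> Y \<in> carrier E" "X \<oplus>\<^bsub>E\<^esub> Y = Y \<oplus>\<^bsub>E\<^esub> X"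
    by (elim class_cases; simp add: class_add class_eq_iff prolongation_rel.swap)+
next
  fix X Y Z assume "X \<in> carrier E" "Y \<in> carrier E" "Z \<in> carrier E"
  then show "X \<oplus>\<^bsub>E\<^esub> Y \<oplus>\<^bsub>E\<^esub> Z = X \<oplus>\<^bsub>E\<^esub> (Y \<oplus>\<^bsub>E\<^esub> Z)"
    by (auto elim!: class_cases simp: class_add)
next
  fix X assume "X \<in> carrier E"
  then show "\<zero>\<^bsub>E\<^esub> \<oplus>\<^bsub>E\<^esub> X = X"
    by (auto elim!: class_cases simp: class_add prolongation_simps(2))
qed (simp add: prolongation_simps(2))

lemma prolongation_wedge_add_left:
  "\<lbrakk>x \<in> carrier (forms1 K); x' \<in> carrier (forms1 K); y \<in> carrier (forms1 K)\<rbrakk> \<Longrightarrow>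
    (x \<oplus>\<^bsub>forms1 K\<^esub> x') \<diamondop>\<^bsub>E\<^esub> y = (x \<diamondop>\<^bsub>E\<^esub> y) \<oplus>\<^bsub>E\<^esub> (x' \<diamondop>\<^bsub>E\<^esub> y)"
  by (simp add: prolongation_simps(3) class_add class_eq_iff prolongation_rel.left_add)

lemma prolongation_wedge_add_right:
  "\<lbrakk>x \<in> carrier (forms1 K); y \<in> carrier (forms1 K); y' \<in> carrier (forms1 K)\<rbrakk> \<Longrightarrow>
    x \<diamondop>\<^bsub>E\<^esub> (y \<oplus>\<^bsub>forms1 K\<^esub> y') = (x \<diamondop>\<^bsub>E\<^esub> y) \<oplus>\<^bsub>E\<^esub> (x \<diamondop>\<^bsub>E\<^esub> y')"
  by (simp add: prolongation_simps(3) class_add class_eq_iff prolongation_rel.right_add)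

lemma class_fneg:
  assumes "u \<in> formal_products"
  shows "form_class R (fneg u) \<oplus>\<^bsub>E\<^esub> form_class R u = \<zero>\<^bsub>E\<^esub>"
  using assms
proof (induction rule: formal_products_induct)
  case Nil
  then show ?case by (simp add: class_add prolongation_simps(2))
next
  case xy: (Cons x y u)
  interpret abelian_monoid E
    by (rule prolongation_abelian_monoid)
  have "\<zero>\<^bsub>forms1 K\<^esub> \<diamondop>\<^bsub>E\<^esub> y = \<zero>\<^bsub>E\<^esub>"
    using xy by (simp add: prolongation_simps(2,3) class_eq_iff prolongation_rel.left_zero)
  then have z: "(\<ominus>\<^bsub>forms1 K\<^esub> x) \<diamondop>\<^bsub>E\<^esub> y \<oplus>\<^bsub>E\<^esub> x \<diamondop>\<^bsub>E\<^esub> y = \<zero>\<^bsub>E\<^esub>"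
    using xy by (simp add: W.B.l_neg flip: prolongation_wedge_add_left)
  have "form_class R (fneg ((x, y) # u)) \<oplus>\<^bsub>E\<^esub> form_class R ((x, y) # u)
      = ((\<ominus>\<^bsub>forms1 K\<^esub> x) \<diamondop>\<^bsub>E\<^esub> y \<oplus>\<^bsub>E\<^esub> x \<diamondop>\<^bsub>E\<^esub> y) \<oplus>\<^bsub>E\<^esub> (form_class R (fneg u) \<oplus>\<^bsub>E\<^esub> form_class R u)"
    using xy(1-3) by (simp add: class_Cons a_ac)
  then show ?case
    using z xy by simp
qed

lemma prolongation_abelian_group: "abelian_group E"
proof -
  interpret abelian_monoid E
    by (rule prolongation_abelian_monoid)
  show ?thesis
  proof (rule abelian_groupI)
    fix X assume "X \<in> carrier E"
    then obtain u where "u \<in> formal_products" "X = form_class R u"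
      by (rule class_cases)
    then show "\<exists>Y\<in>carrier E. Y \<oplus>\<^bsub>E\<^esub> X = \<zero>\<^bsub>E\<^esub>"
      by (intro bexI[of _ "form_class R (fneg u)"]) (simp_all add: class_fneg)
  qed (simp_all add: a_ac)
qed

lemma prolongation_wedge_lact:
  "\<lbrakk>a \<in> carrier (alg K); x \<in> carrier (forms1 K); y \<in> carrier (forms1 K)\<rbrakk> \<Longrightarrow>
    (a \<odot>\<^bsub>forms1 K\<^esub> x) \<diamondop>\<^bsub>E\<^esub> y = a \<odot>\<^bsub>E\<^esub> (x \<diamondop>\<^bsub>E\<^esub> y)"
  and prolongation_wedge_balanced:
  "\<lbrakk>a \<in> carrier (alg K); x \<in> carrier (forms1 K); y \<in> carrier (forms1 K)\<rbrakk> \<Longrightarrow>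
    (x \<star>\<^bsub>forms1 K\<^esub> a) \<diamondop>\<^bsub>E\<^esub> y = x \<diamondop>\<^bsub>E\<^esub> (a \<odot>\<^bsub>forms1 K\<^esub> y)"
  and prolongation_wedge_ract:
  "\<lbrakk>a \<in> carrier (alg K); x \<in> carrier (forms1 K); y \<in> carrier (forms1 K)\<rbrakk> \<Longrightarrow>
    x \<diamondop>\<^bsub>E\<^esub> (y \<star>\<^bsub>forms1 K\<^esub> a) = (x \<diamondop>\<^bsub>E\<^esub> y) \<star>\<^bsub>E\<^esub> a"
  by (simp_all add: prolongation_simps(3) class_lact class_ract class_eq_iff prolongation_rel.balanced)

text \<open>
  Reduces the bimodule axioms to products \<open>x y\<close>, where they are axioms of the bimodule of 1-forms.
\<close>

lemma prolongation_generated [consumes 1]: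
  assumes "X \<in> carrier E" and "P \<zero>\<^bsub>E\<^esub>"
    and "\<And>x y Y. \<lbrakk>x \<in> carrier (forms1 K); y \<in> carrier (forms1 K); Y \<in> carrier E; P Y\<rbrakk> \<Longrightarrow>
      P ((x \<diamondop>\<^bsub>E\<^esub> y) \<oplus>\<^bsub>E\<^esub> Y)"
  shows "P X"
proof -
  obtain u where "u \<in> formal_products" and X: "X = form_class R u"
    using \<open>X \<in> carrier E\<close> by (rule class_cases)
  from this(1) have "P (form_class R u)"
    by (induction rule: formal_products_induct)
      (use assms(2,3) in \<open>simp_all add: class_Cons prolongation_simps(2)\<close>)
  with X show ?thesis by simp
qed

lemma prolongation_bimodule: "bimodule (alg K) E"
proof -
  interpret E: abelian_group E
    by (rule prolongation_abelian_group)
  have lact_closed: "a \<odot>\<^bsub>E\<^esub> X \<in> carrier E" and ract_closed: "X \<star>\<^bsub>E\<^esub> a \<in> carrier E"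
    if "a \<in> carrier (alg K)" "X \<in> carrier E" for a X
    using that by (auto elim!: class_cases simp: class_lact class_ract)
  have lact_add: "a \<odot>\<^bsub>E\<^esub> (X \<oplus>\<^bsub>E\<^esub> Y) = a \<odot>\<^bsub>E\<^esub> X \<oplus>\<^bsub>E\<^esub> a \<odot>\<^bsub>E\<^esub> Y"
    and ract_add: "(X \<oplus>\<^bsub>E\<^esub> Y) \<star>\<^bsub>E\<^esub> a = X \<star>\<^bsub>E\<^esub> a \<oplus>\<^bsub>E\<^esub> Y \<star>\<^bsub>E\<^esub> a"
    if "a \<in> carrier (alg K)" "X \<in> carrier E" "Y \<in> carrier E" for a X Y
    using that by (auto elim!: class_cases simp: class_add class_lact class_ract)
  have zero: "a \<odot>\<^bsub>E\<^esub> \<zero>\<^bsub>E\<^esub> = \<zero>\<^bsub>E\<^esub>" "\<zero>\<^bsub>E\<^esub> \<star>\<^bsub>E\<^esub> a = \<zero>\<^bsub>E\<^esub>" if "a \<in> carrier (alg K)" for a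
    using that by (simp_all add: prolongation_simps(2) class_lact class_ract)
  note wedge = prolongation_wedge_lact[symmetric] prolongation_wedge_ract[symmetric]
  note simps = lact_closed ract_closed lact_add ract_add zero wedge
  have one: "\<one>\<^bsub>alg K\<^esub> \<odot>\<^bsub>E\<^esub> X = X" "X \<star>\<^bsub>E\<^esub> \<one>\<^bsub>alg K\<^esub> = X" if "X \<in> carrier E" for X
    using that by (induction rule: prolongation_generated) (simp_all add: simps)
  have add: "(a \<oplus>\<^bsub>alg K\<^esub> b) \<odot>\<^bsub>E\<^esub> X = a \<odot>\<^bsub>E\<^esub> X \<oplus>\<^bsub>E\<^esub> b \<odot>\<^bsub>E\<^esub> X"
    "X \<star>\<^bsub>E\<^esub> (a \<oplus>\<^bsub>alg K\<^esub> b) = X \<star>\<^bsub>E\<^esub> a \<oplus>\<^bsub>E\<^esub> X \<star>\<^bsub>E\<^esub> b"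
    if "X \<in> carrier E" and ab: "a \<in> carrier (alg K)" "b \<in> carrier (alg K)" for a b X
    using that(1)
    by (induction rule: prolongation_generated)
       (simp_all add: simps ab W.lact_add_left W.ract_add_right prolongation_wedge_add_left
          prolongation_wedge_add_right E.a_ac)
  have mult: "(a \<otimes>\<^bsub>alg K\<^esub> b) \<odot>\<^bsub>E\<^esub> X = a \<odot>\<^bsub>E\<^esub> (b \<odot>\<^bsub>E\<^esub> X)"
    "X \<star>\<^bsub>E\<^esub> (a \<otimes>\<^bsub>alg K\<^esub> b) = X \<star>\<^bsub>E\<^esub> a \<star>\<^bsub>E\<^esub> b" "(a \<odot>\<^bsub>E\<^esub> X) \<star>\<^bsub>E\<^esub> b = a \<odot>\<^bsub>E\<^esub> (X \<star>\<^bsub>E\<^esub> b)"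
    if "X \<in> carrier E" and ab: "a \<in> carrier (alg K)" "b \<in> carrier (alg K)" for a b X
    using that(1)
    by (induction rule: prolongation_generated)
       (simp_all add: simps ab W.lact_mult W.ract_mult)
  show ?thesis
    unfolding bimodule_def
    by (intro conjI ballI)
       (assumption | rule W.A.ring_axioms E.abelian_group_axioms lact_closed ract_closed
          lact_add ract_add one add mult)+
qed

lemma prolongation_dif_closed [simp]: "x \<in> carrier (forms1 K) \<Longrightarrow> dif E x \<in> carrier E"
  by (simp add: prolongation_simps(4))

lemma prolongation_dif_sum_adb:
  assumes "r \<in> formal_exact_terms"
  shows "dif E (sum_adb r) = form_class R (fdd r)"
proof -
  have "sum_adb r \<in> carrier (forms1 K)"
    using assms by simp
  then obtain r' where r': "r' \<in> formal_exact_terms" "sum_adb r' = sum_adb r"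
    "fdif (sum_adb r) = fdd r'"
    by (rule fdifE)
  then show ?thesis
    using assms by (simp add: prolongation_simps(4) class_eq_iff prolongation_rel.prolong)
qed

lemma prolongation_dif_add:
  assumes "x \<in> carrier (forms1 K)" "y \<in> carrier (forms1 K)"
  shows "dif E (x \<oplus>\<^bsub>forms1 K\<^esub> y) = dif E x \<oplus>\<^bsub>E\<^esub> dif E y"
proof -
  obtain r r' where r: "r \<in> formal_exact_terms" "sum_adb r = x"
    and r': "r' \<in> formal_exact_terms" "sum_adb r' = y"
    using assms sum_adb_surj by meson
  have "dif E (x \<oplus>\<^bsub>forms1 K\<^esub> y) = form_class R (fdd (r @ r'))"
    using r r' prolongation_dif_sum_adb[of "r @ r'"] by (simp add: sum_adb_append)
  also have "\<dots> = dif E x \<oplus>\<^bsub>E\<^esub> dif E y"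
    using r r' prolongation_dif_sum_adb[of r] prolongation_dif_sum_adb[of r'] by (simp add: class_add)
  finally show ?thesis .
qed

lemma prolongation_dif_adb:
  "\<lbrakk>a \<in> carrier (alg K); b \<in> carrier (alg K)\<rbrakk> \<Longrightarrow> dif E (a \<odot>\<^bsub>forms1 K\<^esub> dd K b) = dd K a \<diamondop>\<^bsub>E\<^esub> dd K b"
  using prolongation_dif_sum_adb[of "[(a, b)]"] by (simp add: prolongation_simps(3))

lemma prolongation_dif_dd:
  assumes "b \<in> carrier (alg K)"
  shows "dif E (dd K b) = \<zero>\<^bsub>E\<^esub>"
proof -
  interpret E: abelian_group E
    by (rule prolongation_abelian_group)
  have "\<zero>\<^bsub>forms1 K\<^esub> \<diamondop>\<^bsub>E\<^esub> dd K b = \<zero>\<^bsub>E\<^esub>"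
    using assms by (simp add: prolongation_simps(2,3) class_eq_iff prolongation_rel.left_zero)
  then show ?thesis
    using assms prolongation_dif_adb[of "\<one>\<^bsub>alg K\<^esub>" b] by simp
qed

text \<open>On \<open>x = b dc\<close> this is \<open>d(ab) dc = da (b dc) + a db dc\<close>.\<close>

lemma prolongation_dif_lact:
  assumes x: "x \<in> carrier (forms1 K)" and a: "a \<in> carrier (alg K)"
  shows "dif E (a \<odot>\<^bsub>forms1 K\<^esub> x) = (dd K a \<diamondop>\<^bsub>E\<^esub> x) \<oplus>\<^bsub>E\<^esub> (a \<odot>\<^bsub>E\<^esub> dif E x)"
proof -
  interpret E: bimod "alg K" E
    by (intro bimodule_imp_bimod prolongation_bimodule)
  show ?thesis
    using x
  proof (induction rule: forms1_generated)
    case (adb b c)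
    have "dif E (a \<odot>\<^bsub>forms1 K\<^esub> (b \<odot>\<^bsub>forms1 K\<^esub> dd K c)) = dd K (a \<otimes>\<^bsub>alg K\<^esub> b) \<diamondop>\<^bsub>E\<^esub> dd K c"
      using a adb prolongation_dif_adb[of "a \<otimes>\<^bsub>alg K\<^esub> b" c] by (simp add: W.lact_mult)
    then show ?case
      using a adb
      by (simp add: dd_mult prolongation_wedge_add_left prolongation_wedge_lact
          prolongation_wedge_balanced prolongation_dif_adb)
  next
    case (add x y)
    then show ?case
      using a by (simp add: W.lact_add prolongation_dif_add prolongation_wedge_add_right
          E.lact_add E.B.a_ac)
  qed
qed

text \<open>
  The representation \<open>(b dc)a + (bc) da = b d(ca)\<close> determines \<open>d((b dc)a)\<close>.  To avoid signs, the
  induction proves \<open>d(xa) + x da = (dx)a\<close>.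
\<close>

lemma prolongation_dif_ract:
  assumes x: "x \<in> carrier (forms1 K)" and a: "a \<in> carrier (alg K)"
  shows "dif E (x \<star>\<^bsub>forms1 K\<^esub> a) = (dif E x \<star>\<^bsub>E\<^esub> a) \<ominus>\<^bsub>E\<^esub> (x \<diamondop>\<^bsub>E\<^esub> dd K a)"
proof -
  interpret E: bimod "alg K" E
    by (intro bimodule_imp_bimod prolongation_bimodule)
  have "dif E (x \<star>\<^bsub>forms1 K\<^esub> a) \<oplus>\<^bsub>E\<^esub> (x \<diamondop>\<^bsub>E\<^esub> dd K a) = dif E x \<star>\<^bsub>E\<^esub> a"
    using x
  proof (induction rule: forms1_generated)
    case (adb b c)
    note [simp] = a adb
    have "dif E ((b \<odot>\<^bsub>forms1 K\<^esub> dd K c) \<star>\<^bsub>forms1 K\<^esub> a) \<oplus>\<^bsub>E\<^esub> dd K (b \<otimes>\<^bsub>alg K\<^esub> c) \<diamondop>\<^bsub>E\<^esub> dd K a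
        = dif E ((b \<odot>\<^bsub>forms1 K\<^esub> dd K c) \<star>\<^bsub>forms1 K\<^esub> a \<oplus>\<^bsub>forms1 K\<^esub> (b \<otimes>\<^bsub>alg K\<^esub> c) \<odot>\<^bsub>forms1 K\<^esub> dd K a)"
      by (simp add: prolongation_dif_add prolongation_dif_adb)
    also have "(b \<odot>\<^bsub>forms1 K\<^esub> dd K c) \<star>\<^bsub>forms1 K\<^esub> a \<oplus>\<^bsub>forms1 K\<^esub> (b \<otimes>\<^bsub>alg K\<^esub> c) \<odot>\<^bsub>forms1 K\<^esub> dd K a
        = b \<odot>\<^bsub>forms1 K\<^esub> dd K (c \<otimes>\<^bsub>alg K\<^esub> a)"
      by (simp add: dd_mult W.lact_add W.lact_ract W.lact_mult)
    finally have "dif E ((b \<odot>\<^bsub>forms1 K\<^esub> dd K c) \<star>\<^bsub>forms1 K\<^esub> a) \<oplus>\<^bsub>E\<^esub> dd K (b \<otimes>\<^bsub>alg K\<^esub> c) \<diamondop>\<^bsub>E\<^esub> dd K a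
        = dd K b \<diamondop>\<^bsub>E\<^esub> dd K (c \<otimes>\<^bsub>alg K\<^esub> a)"
      by (simp add: prolongation_dif_adb)
    then have "(dif E ((b \<odot>\<^bsub>forms1 K\<^esub> dd K c) \<star>\<^bsub>forms1 K\<^esub> a) \<oplus>\<^bsub>E\<^esub> b \<odot>\<^bsub>E\<^esub> (dd K c \<diamondop>\<^bsub>E\<^esub> dd K a))
          \<oplus>\<^bsub>E\<^esub> dd K b \<diamondop>\<^bsub>E\<^esub> (c \<odot>\<^bsub>forms1 K\<^esub> dd K a)
        = (dd K b \<diamondop>\<^bsub>E\<^esub> dd K c) \<star>\<^bsub>E\<^esub> a \<oplus>\<^bsub>E\<^esub> dd K b \<diamondop>\<^bsub>E\<^esub> (c \<odot>\<^bsub>forms1 K\<^esub> dd K a)"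
      by (simp add: dd_mult prolongation_wedge_add_left prolongation_wedge_add_right
          prolongation_wedge_lact prolongation_wedge_balanced prolongation_wedge_ract E.B.a_ac)
    then show ?case
      by (simp add: prolongation_dif_adb prolongation_wedge_lact)
  next
    case (add x y)
    have c: "dif E (x \<star>\<^bsub>forms1 K\<^esub> a) \<in> carrier E" "dif E (y \<star>\<^bsub>forms1 K\<^esub> a) \<in> carrier E"
      "x \<diamondop>\<^bsub>E\<^esub> dd K a \<in> carrier E" "y \<diamondop>\<^bsub>E\<^esub> dd K a \<in> carrier E"
      using a add by simp_all
    have "dif E ((x \<oplus>\<^bsub>forms1 K\<^esub> y) \<star>\<^bsub>forms1 K\<^esub> a) \<oplus>\<^bsub>E\<^esub> ((x \<oplus>\<^bsub>forms1 K\<^esub> y) \<diamondop>\<^bsub>E\<^esub> dd K a)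
        = (dif E (x \<star>\<^bsub>forms1 K\<^esub> a) \<oplus>\<^bsub>E\<^esub> dif E (y \<star>\<^bsub>forms1 K\<^esub> a))
          \<oplus>\<^bsub>E\<^esub> (x \<diamondop>\<^bsub>E\<^esub> dd K a \<oplus>\<^bsub>E\<^esub> y \<diamondop>\<^bsub>E\<^esub> dd K a)"
      using a add(1,2) by (simp add: W.ract_add prolongation_dif_add prolongation_wedge_add_left)
    also have "\<dots> = (dif E (x \<star>\<^bsub>forms1 K\<^esub> a) \<oplus>\<^bsub>E\<^esub> x \<diamondop>\<^bsub>E\<^esub> dd K a)
        \<oplus>\<^bsub>E\<^esub> (dif E (y \<star>\<^bsub>forms1 K\<^esub> a) \<oplus>\<^bsub>E\<^esub> y \<diamondop>\<^bsub>E\<^esub> dd K a)"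
      using c by (simp add: E.B.a_ac)
    also have "\<dots> = dif E (x \<oplus>\<^bsub>forms1 K\<^esub> y) \<star>\<^bsub>E\<^esub> a"
      using a add by (simp add: prolongation_dif_add E.ract_add)
    finally show ?case .
  qed
  moreover have "dif E (x \<star>\<^bsub>forms1 K\<^esub> a) = (dif E (x \<star>\<^bsub>forms1 K\<^esub> a) \<oplus>\<^bsub>E\<^esub> (x \<diamondop>\<^bsub>E\<^esub> dd K a)) \<ominus>\<^bsub>E\<^esub> (x \<diamondop>\<^bsub>E\<^esub> dd K a)"
    using x a by (simp add: E.B.add_minus_cancel)
  ultimately show ?thesis
    by simp
qed

lemma prolongation_extension: "two_form_extension K E"
  unfolding two_form_extension_def
  by (intro conjI ballI)
     (assumption | rule prolongation_bimodule prolongation_dif_closed prolongation_wedge_closed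
        prolongation_dif_add prolongation_wedge_add_left prolongation_wedge_add_right
        prolongation_wedge_lact prolongation_wedge_balanced prolongation_wedge_ract
        prolongation_dif_lact prolongation_dif_ract prolongation_dif_dd)+

lemma prolongation_generated_by_products: "generated_by_products K E"
proof -
  interpret E: abelian_group E
    by (rule prolongation_abelian_group)
  let ?G = "{x \<diamondop>\<^bsub>E\<^esub> y | x y. x \<in> carrier (forms1 K) \<and> y \<in> carrier (forms1 K)}"
  have "?G \<subseteq> carrier E"
    by auto
  then have "generate (add_monoid E) ?G \<subseteq> carrier E"
    using E.add.generate_incl[of ?G] by simp
  moreover have "X \<in> generate (add_monoid E) ?G" if "X \<in> carrier E" for X
    using that
  proof (induction rule: prolongation_generated)
    case 1
    then show ?case using generate.one[of "add_monoid E" ?G] by simp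
  next
    case (2 x y Y)
    then have "x \<diamondop>\<^bsub>E\<^esub> y \<in> generate (add_monoid E) ?G"
      by (intro generate.incl) blast
    then show ?case
      using generate.eng[of _ "add_monoid E" ?G Y] 2 by simp
  qed
  ultimately show ?thesis
    unfolding generated_by_products_def by blast
qed

end

end

definition eval_products :: "('a, 'w, 'e) two_forms \<Rightarrow> ('w \<times> 'w) list \<Rightarrow> 'e" where
  "eval_products F u = foldr (\<lambda>(x, y) z. (x \<diamondop>\<^bsub>F\<^esub> y) \<oplus>\<^bsub>F\<^esub> z) u \<zero>\<^bsub>F\<^esub>"

lemma eval_products_simps [simp]:
  "eval_products F [] = \<zero>\<^bsub>F\<^esub>"
  "eval_products F ((x, y) # u) = (x \<diamondop>\<^bsub>F\<^esub> y) \<oplus>\<^bsub>F\<^esub> eval_products F u"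
  by (simp_all add: eval_products_def)

context two_form_setting
begin

abbreviation "ev \<equiv> eval_products F"

lemma ev_closed [simp]: "u \<in> formal_products \<Longrightarrow> ev u \<in> carrier F"
  by (induction rule: formal_products_induct) simp_all

lemma ev_append: "\<lbrakk>u \<in> formal_products; v \<in> formal_products\<rbrakk> \<Longrightarrow> ev (u @ v) = ev u \<oplus>\<^bsub>F\<^esub> ev v"
  by (induction rule: formal_products_induct) (simp_all add: E.B.a_assoc)

lemma ev_fneg: "u \<in> formal_products \<Longrightarrow> ev (fneg u) = \<ominus>\<^bsub>F\<^esub> ev u"
  by (induction rule: formal_products_induct) (simp_all add: E.B.minus_add wedge_uminus_left)

lemma ev_flact: "\<lbrakk>u \<in> formal_products; a \<in> carrier (alg K)\<rbrakk> \<Longrightarrow> ev (flact a u) = a \<odot>\<^bsub>F\<^esub> ev u"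
  by (induction rule: formal_products_induct) (simp_all add: wedge_lact E.lact_add)

lemma ev_fract: "\<lbrakk>u \<in> formal_products; a \<in> carrier (alg K)\<rbrakk> \<Longrightarrow> ev (fract u a) = ev u \<star>\<^bsub>F\<^esub> a"
  by (induction rule: formal_products_induct) (simp_all add: wedge_ract E.ract_add)

lemma ev_fdd: "r \<in> formal_exact_terms \<Longrightarrow> ev (fdd r) = dif F (sum_adb r)"
  by (induction rule: formal_exact_terms_induct) (simp_all add: dif_add dif_lact)

lemma ev_fdif: "x \<in> carrier (forms1 K) \<Longrightarrow> ev (fdif x) = dif F x"
  by (erule fdifE) (simp add: ev_fdd)

text \<open>
  In every extension \<open>\<Sum> da db\<close> is \<open>d(\<Sum> a db)\<close> and hence depends on \<open>\<Sum> a db\<close> only, so the clause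
  \<open>prolong\<close> is sound; the other clauses are axioms of an extension.
\<close>

lemma ev_invariant:
  assumes R: "\<And>u v. (u, v) \<in> R \<Longrightarrow> u \<in> formal_products \<Longrightarrow> v \<in> formal_products \<Longrightarrow> ev u = ev v"
  shows "prolongation_rel R u v \<Longrightarrow> ev u = ev v"
proof (induction rule: prolongation_rel.induct)
  case (append u v u' v')
  then show ?case
    using prolongation_rel_closed[OF append(1)] prolongation_rel_closed[OF append(2)]
    by (simp add: ev_append)
next
  case (lact a u v)
  then show ?case
    using prolongation_rel_closed[OF lact(2)] by (simp add: ev_flact)
next
  case (ract a u v)
  then show ?case
    using prolongation_rel_closed[OF ract(2)] by (simp add: ev_fract)
qed (simp_all add: R ev_fdd ev_append wedge_balanced wedge_add_left wedge_add_right E.B.a_comm)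

lemma prolongation_universal:
  assumes R: "\<And>u v. (u, v) \<in> R \<Longrightarrow> u \<in> formal_products \<Longrightarrow> v \<in> formal_products \<Longrightarrow> ev u = ev v"
  shows "\<exists>q. extension_hom K (prolongation R) F q"
proof -
  define q where "q X = ev (SOME u. u \<in> X)" for X
  have q: "q (form_class R u) = ev u" if "u \<in> formal_products" for u
  proof -
    have "u \<in> form_class R u"
      using that by (simp add: form_class_def prolongation_rel.refl)
    then have "(SOME v. v \<in> form_class R u) \<in> form_class R u"
      by (rule someI)
    then show ?thesis
      unfolding q_def using ev_invariant[OF R] by (auto simp: form_class_def)
  qed
  have "extension_hom K (prolongation R) F q"
    unfolding extension_hom_def
  proof (intro conjI ballI)
    fix u v a x y
    show "u \<in> carrier (prolongation R) \<Longrightarrow> q u \<in> carrier F"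
      by (erule class_cases) (simp add: q)
    show "u \<in> carrier (prolongation R) \<Longrightarrow> v \<in> carrier (prolongation R) \<Longrightarrow>
        q (u \<oplus>\<^bsub>prolongation R\<^esub> v) = q u \<oplus>\<^bsub>F\<^esub> q v"
      by (elim class_cases) (simp add: q class_add ev_append)
    show "a \<in> carrier (alg K) \<Longrightarrow> u \<in> carrier (prolongation R) \<Longrightarrow>
        q (a \<odot>\<^bsub>prolongation R\<^esub> u) = a \<odot>\<^bsub>F\<^esub> q u"
      by (elim class_cases) (simp add: q class_lact ev_flact)
    show "a \<in> carrier (alg K) \<Longrightarrow> u \<in> carrier (prolongation R) \<Longrightarrow>
        q (u \<star>\<^bsub>prolongation R\<^esub> a) = q u \<star>\<^bsub>F\<^esub> a"
      by (elim class_cases) (simp add: q class_ract ev_fract)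
    show "x \<in> carrier (forms1 K) \<Longrightarrow> q (dif (prolongation R) x) = dif F x"
      by (simp add: prolongation_simps(4) q ev_fdif)
    show "x \<in> carrier (forms1 K) \<Longrightarrow> y \<in> carrier (forms1 K) \<Longrightarrow>
        q (x \<diamondop>\<^bsub>prolongation R\<^esub> y) = x \<diamondop>\<^bsub>F\<^esub> y"
      by (simp add: prolongation_simps(3) q)
  qed
  then show ?thesis by blast
qed

end

context first_order_setting
begin

lemma eval_products_prolongation: "u \<in> formal_products \<Longrightarrow>
    eval_products (prolongation R) u = form_class R u"
  by (induction rule: formal_products_induct) (simp_all add: class_Cons prolongation_simps(2))

lemma prolongation_satisfies:
  assumes "(u, v) \<in> R" "u \<in> formal_products" "v \<in> formal_products"
  shows "eval_products (prolongation R) u = eval_products (prolongation R) v"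
  using assms by (simp add: eval_products_prolongation class_eq_iff prolongation_rel.base)

end

section \<open>The conformal calculus on the crossed product\<close>

locale conformal_calculus_setting = riemannian_geometry M
  for M :: "('m::{t2_space,second_countable_topology}, 'n::finite) riemannian" +
  fixes \<zeta> \<tau> :: "'m vfield" and \<beta> :: "'m scalar_fn" and lam :: real
    and K :: "('m, 'a, 'w) calculus"
  assumes zeta_vfield [simp]: "\<zeta> \<in> vector_fields M"
    and tau_vfield [simp]: "\<tau> \<in> vector_fields M"
    and beta_smooth [simp]: "\<beta> \<in> smooth_functions M"
    and calculus: "conformal_calculus M \<zeta> \<tau> \<beta> lam K"
begin

abbreviation \<alpha> where "\<alpha> \<equiv> alpha M \<tau>"

lemma crossed: "crossed_product M \<tau> lam K"
  using calculus by (simp add: conformal_calculus_def)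

sublocale first_order_setting K
  using calculus by unfold_locales (simp add: conformal_calculus_def)

lemma emb_closed [simp]: "f \<in> smooth_functions M \<Longrightarrow> emb K f \<in> carrier (alg K)"
  and tvar_closed [simp]: "tvar K \<in> carrier (alg K)"
  and emb_one [simp]: "emb K 1 = \<one>\<^bsub>alg K\<^esub>"
  using crossed by (simp_all add: crossed_product_def)

lemma emb_add: "\<lbrakk>f \<in> smooth_functions M; g \<in> smooth_functions M\<rbrakk> \<Longrightarrow>
    emb K (f + g) = emb K f \<oplus>\<^bsub>alg K\<^esub> emb K g"
  and emb_mult: "\<lbrakk>f \<in> smooth_functions M; g \<in> smooth_functions M\<rbrakk> \<Longrightarrow>
    emb K (f * g) = emb K f \<otimes>\<^bsub>alg K\<^esub> emb K g"
  and emb_tvar: "f \<in> smooth_functions M \<Longrightarrow>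
    emb K f \<otimes>\<^bsub>alg K\<^esub> tvar K \<ominus>\<^bsub>alg K\<^esub> tvar K \<otimes>\<^bsub>alg K\<^esub> emb K f = emb K ((\<lambda>_. lam) * \<tau> f)"
  using crossed by (simp_all add: crossed_product_def)

lemma emb_comm: "\<lbrakk>f \<in> smooth_functions M; g \<in> smooth_functions M\<rbrakk> \<Longrightarrow>
    emb K f \<otimes>\<^bsub>alg K\<^esub> emb K g = emb K g \<otimes>\<^bsub>alg K\<^esub> emb K f"
  using emb_mult[of f g] emb_mult[of g f] by (simp add: mult.commute)

lemma emb_zero [simp]: "emb K 0 = \<zero>\<^bsub>alg K\<^esub>"
  using emb_add[of 0 0] W.A.add.l_cancel_one'[of "emb K 0" "emb K 0"] by simp

lemma emb_uminus: "f \<in> smooth_functions M \<Longrightarrow> emb K (- f) = \<ominus>\<^bsub>alg K\<^esub> emb K f"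
  using emb_add[of "- f" f] by (intro W.A.minus_equality[symmetric]) simp_all

lemma emb_diff: "\<lbrakk>f \<in> smooth_functions M; g \<in> smooth_functions M\<rbrakk> \<Longrightarrow>
    emb K (f - g) = emb K f \<ominus>\<^bsub>alg K\<^esub> emb K g"
  using emb_add[of f "- g"] by (simp add: emb_uminus W.A.minus_eq)

text \<open>The constant term \<open>t\<^sup>0\<close> is covered by the functions, as the unit is the function \<open>1\<close>.\<close>

lemma alg_generated [consumes 1, case_names emb tvar add mult]:
  assumes "a \<in> carrier (alg K)"
    and emb: "\<And>f. f \<in> smooth_functions M \<Longrightarrow> P (emb K f)"
    and tvar: "P (tvar K)"
    and add: "\<And>a b. \<lbrakk>a \<in> carrier (alg K); b \<in> carrier (alg K); P a; P b\<rbrakk> \<Longrightarrow> P (a \<oplus>\<^bsub>alg K\<^esub> b)"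
    and mult: "\<And>a b. \<lbrakk>a \<in> carrier (alg K); b \<in> carrier (alg K); P a; P b\<rbrakk> \<Longrightarrow> P (a \<otimes>\<^bsub>alg K\<^esub> b)"
  shows "P a"
proof -
  have pow: "P (tvar K [^]\<^bsub>alg K\<^esub> (i::nat))" for i
  proof (induction i)
    case 0
    then show ?case using emb[OF smooth_one] by simp
  next
    case (Suc i)
    then show ?case using mult tvar by simp
  qed
  obtain c where c: "\<And>i. c i \<in> smooth_functions M" "finite {i. c i \<noteq> 0}"
    "a = (\<Oplus>\<^bsub>alg K\<^esub>i\<in>{i. c i \<noteq> 0}. emb K (c i) \<otimes>\<^bsub>alg K\<^esub> (tvar K [^]\<^bsub>alg K\<^esub> (i::nat)))"
    using crossed \<open>a \<in> carrier (alg K)\<close> unfolding crossed_product_def by blast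
  have "P (\<Oplus>\<^bsub>alg K\<^esub>i\<in>I. emb K (c i) \<otimes>\<^bsub>alg K\<^esub> (tvar K [^]\<^bsub>alg K\<^esub> (i::nat)))" if "finite I" for I
    using that
  proof induction
    case empty
    then show ?case using emb[OF smooth_zero] by simp
  next
    case (insert i I)
    then show ?case
      by (subst W.A.finsum_insert) (auto intro!: add mult emb pow W.A.finsum_closed emb_closed c)
  qed
  with c show ?thesis by simp
qed

lemma rscal_closed [simp]: "rscal K c \<in> carrier (alg K)"
  by (simp add: rscal_def)

lemma rscal_one [simp]: "rscal K 1 = \<one>\<^bsub>alg K\<^esub>"
  using emb_one by (simp add: rscal_def one_fun_def)

lemma rscal_mult: "rscal K c \<otimes>\<^bsub>alg K\<^esub> rscal K e = rscal K (c * e)"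
  using emb_mult[of "\<lambda>_. c" "\<lambda>_. e"] by (simp add: rscal_def times_fun_def)

lemma rscal_add: "rscal K c \<oplus>\<^bsub>alg K\<^esub> rscal K e = rscal K (c + e)"
  using emb_add[of "\<lambda>_. c" "\<lambda>_. e"] by (simp add: rscal_def plus_fun_def)

text \<open>Constants commute with \<open>t\<close> because \<open>\<tau>\<close> kills them.\<close>

lemma rscal_central: "a \<in> carrier (alg K) \<Longrightarrow>
    rscal K c \<otimes>\<^bsub>alg K\<^esub> a = a \<otimes>\<^bsub>alg K\<^esub> rscal K c"
proof (induction rule: alg_generated)
  case (emb f)
  then show ?case by (simp add: rscal_def emb_comm)
next
  case tvar
  have "rscal K c \<otimes>\<^bsub>alg K\<^esub> tvar K \<ominus>\<^bsub>alg K\<^esub> tvar K \<otimes>\<^bsub>alg K\<^esub> rscal K c = \<zero>\<^bsub>alg K\<^esub>"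
    unfolding rscal_def emb_tvar[OF smooth_const] vfield_const[OF tau_vfield]
      mult_zero_right emb_zero ..
  then show ?case by (simp add: W.A.minus_eq_zero_iff)
next
  case (add a b)
  then show ?case by (simp add: W.A.l_distr W.A.r_distr)
next
  case (mult a b)
  then show ?case
    using W.A.m_assoc[of "rscal K c" a b] W.A.m_assoc[of a "rscal K c" b]
      W.A.m_assoc[of a b "rscal K c"]
    by simp
qed

lemma dd_rscal [simp]: "dd K (rscal K c) = \<zero>\<^bsub>forms1 K\<^esub>"
proof -
  have "dd K (rscal K c \<otimes>\<^bsub>alg K\<^esub> \<one>\<^bsub>alg K\<^esub>) = rscal K c \<odot>\<^bsub>forms1 K\<^esub> dd K \<one>\<^bsub>alg K\<^esub>"
    using first_order unfolding first_order_calculus_def by blast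
  then show ?thesis by simp
qed

text \<open>For an exact form both sides are \<open>d(cb) = d(bc)\<close>, because \<open>dc = 0\<close>.\<close>

lemma ract_rscal: "x \<in> carrier (forms1 K) \<Longrightarrow>
    x \<star>\<^bsub>forms1 K\<^esub> rscal K c = rscal K c \<odot>\<^bsub>forms1 K\<^esub> x"
proof (induction rule: forms1_generated)
  case (adb a b)
  have "dd K b \<star>\<^bsub>forms1 K\<^esub> rscal K c = rscal K c \<odot>\<^bsub>forms1 K\<^esub> dd K b"
    using adb dd_mult[of b "rscal K c"] dd_mult[of "rscal K c" b] by (simp add: rscal_central)
  then show ?case
    using adb by (simp add: W.lact_ract rscal_central flip: W.lact_mult)
next
  case (add x y)
  then show ?case by (simp add: W.lact_add W.ract_add)
qed

end

locale scalar_bimod = conformal_calculus_setting M \<zeta> \<tau> \<beta> lam K + B: bimod "alg K" B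
  for M :: "('m::{t2_space,second_countable_topology}, 'n::finite) riemannian"
    and \<zeta> \<tau> \<beta> lam and K :: "('m, 'a, 'w) calculus" and B :: "('a, 'b, 'z) bimod_scheme"
begin

lemma rscal_lact_comm: "\<lbrakk>a \<in> carrier (alg K); x \<in> carrier B\<rbrakk> \<Longrightarrow>
    a \<odot>\<^bsub>B\<^esub> (rscal K c \<odot>\<^bsub>B\<^esub> x) = rscal K c \<odot>\<^bsub>B\<^esub> (a \<odot>\<^bsub>B\<^esub> x)"
  by (simp add: rscal_central flip: B.lact_mult)

lemma rscal_rscal: "x \<in> carrier B \<Longrightarrow>
    rscal K c \<odot>\<^bsub>B\<^esub> (rscal K e \<odot>\<^bsub>B\<^esub> x) = rscal K (c * e) \<odot>\<^bsub>B\<^esub> x"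
  by (simp add: rscal_mult flip: B.lact_mult)

lemma rscal_cancel:
  assumes "c \<noteq> 0" "x \<in> carrier B" "y \<in> carrier B" "rscal K c \<odot>\<^bsub>B\<^esub> x = rscal K c \<odot>\<^bsub>B\<^esub> y"
  shows "x = y"
proof -
  have "rscal K (1 / c) \<odot>\<^bsub>B\<^esub> (rscal K c \<odot>\<^bsub>B\<^esub> x) = rscal K (1 / c) \<odot>\<^bsub>B\<^esub> (rscal K c \<odot>\<^bsub>B\<^esub> y)"
    using assms by simp
  then show ?thesis
    using assms(1-3) by (simp add: rscal_rscal)
qed

lemma rscal_add_left: "x \<in> carrier B \<Longrightarrow>
    (rscal K c \<odot>\<^bsub>B\<^esub> x) \<oplus>\<^bsub>B\<^esub> (rscal K e \<odot>\<^bsub>B\<^esub> x) = rscal K (c + e) \<odot>\<^bsub>B\<^esub> x"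
  by (simp add: rscal_add flip: B.lact_add_left)

lemma bcomm_rscal: "\<lbrakk>a \<in> carrier (alg K); x \<in> carrier B\<rbrakk> \<Longrightarrow>
    bcomm B (rscal K c \<odot>\<^bsub>B\<^esub> x) a = rscal K c \<odot>\<^bsub>B\<^esub> bcomm B x a"
  by (simp add: bcomm_def B.lact_ract rscal_lact_comm B.lact_minus)

end

sublocale conformal_calculus_setting \<subseteq> WS: scalar_bimod M \<zeta> \<tau> \<beta> lam K "forms1 K"
  by unfold_locales

context conformal_calculus_setting
begin

lemma thetap_closed [simp]: "thetap K \<in> carrier (forms1 K)"
  and emb1_closed [simp]: "\<omega> \<in> one_forms M \<Longrightarrow> emb1 K \<omega> \<in> carrier (forms1 K)"
  using calculus by (simp_all add: conformal_calculus_def)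

lemma dt_closed [simp]: "dt K \<in> carrier (forms1 K)"
  by (simp add: dt_def)

lemma emb1_fmul: "\<lbrakk>f \<in> smooth_functions M; \<omega> \<in> one_forms M\<rbrakk> \<Longrightarrow>
    emb1 K (f \<rightharpoondown> \<omega>) = emb K f \<odot>\<^bsub>forms1 K\<^esub> emb1 K \<omega>"
  using calculus by (simp add: conformal_calculus_def)

lemma dd_emb: "f \<in> smooth_functions M \<Longrightarrow> dd K (emb K f)
    = emb1 K (cl_d M f) \<oplus>\<^bsub>forms1 K\<^esub> ftheta K ((\<lambda>_. lam / 2) * drift_laplacian M \<zeta> f)"
  using calculus by (simp add: conformal_calculus_def)

lemma bcomm_emb1_emb: "\<lbrakk>\<omega> \<in> one_forms M; f \<in> smooth_functions M\<rbrakk> \<Longrightarrow>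
    bcomm (forms1 K) (emb1 K \<omega>) (emb K f) = ftheta K ((\<lambda>_. lam) * inv_metric M \<omega> (cl_d M f))"
  using calculus by (simp add: conformal_calculus_def)

lemma bcomm_thetap_emb: "f \<in> smooth_functions M \<Longrightarrow>
    bcomm (forms1 K) (thetap K) (emb K f) = \<zero>\<^bsub>forms1 K\<^esub>"
  and bcomm_thetap_tvar: "bcomm (forms1 K) (thetap K) (tvar K) = ftheta K ((\<lambda>_. lam) * \<alpha>)"
  using calculus by (simp_all add: conformal_calculus_def)

lemma bcomm_dt_emb:
  assumes "f \<in> smooth_functions M"
  shows "bcomm (forms1 K) (dt K) (emb K f) = \<ominus>\<^bsub>forms1 K\<^esub> (rscal K lam \<odot>\<^bsub>forms1 K\<^esub> dd K (emb K f))"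
proof -
  have "\<ominus>\<^bsub>forms1 K\<^esub> bcomm (forms1 K) (dt K) (emb K f) = rscal K lam \<odot>\<^bsub>forms1 K\<^esub> dd K (emb K f)"
    using calculus assms by (simp add: conformal_calculus_def)
  then show ?thesis
    using assms by (metis W.B.minus_minus W.bcomm_closed dt_closed emb_closed)
qed

lemma bcomm_dt_tvar: "bcomm (forms1 K) (dt K) (tvar K)
    = ftheta K ((\<lambda>_. lam) * \<beta>) \<ominus>\<^bsub>forms1 K\<^esub> (rscal K lam \<odot>\<^bsub>forms1 K\<^esub> dt K)"
  using calculus by (simp add: conformal_calculus_def)

lemma ftheta_closed [simp]: "f \<in> smooth_functions M \<Longrightarrow> ftheta K f \<in> carrier (forms1 K)"
  and ftheta_one [simp]: "ftheta K 1 = thetap K"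
  and ftheta_add: "\<lbrakk>f \<in> smooth_functions M; g \<in> smooth_functions M\<rbrakk> \<Longrightarrow>
    ftheta K (f + g) = ftheta K f \<oplus>\<^bsub>forms1 K\<^esub> ftheta K g"
  and ftheta_diff: "\<lbrakk>f \<in> smooth_functions M; g \<in> smooth_functions M\<rbrakk> \<Longrightarrow>
    ftheta K (f - g) = ftheta K f \<ominus>\<^bsub>forms1 K\<^esub> ftheta K g"
  and ftheta_mult: "\<lbrakk>f \<in> smooth_functions M; g \<in> smooth_functions M\<rbrakk> \<Longrightarrow>
    ftheta K (f * g) = emb K f \<odot>\<^bsub>forms1 K\<^esub> ftheta K g"
  and ftheta_scale: "f \<in> smooth_functions M \<Longrightarrow>
    ftheta K ((\<lambda>_. c) * f) = rscal K c \<odot>\<^bsub>forms1 K\<^esub> ftheta K f"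
  by (simp_all add: ftheta_def emb_add emb_diff emb_mult rscal_def
      W.lact_add_left W.lact_minus_left W.lact_mult)

lemma bcomm_ftheta_emb: "\<lbrakk>f \<in> smooth_functions M; g \<in> smooth_functions M\<rbrakk> \<Longrightarrow>
    bcomm (forms1 K) (ftheta K f) (emb K g) = \<zero>\<^bsub>forms1 K\<^esub>"
  using emb_comm[of f g] W.A.r_neg
  by (simp add: ftheta_def W.bcomm_lact bcomm_thetap_emb W.A.minus_eq)

lemma bcomm_ftheta_tvar:
  assumes "f \<in> smooth_functions M"
  shows "bcomm (forms1 K) (ftheta K f) (tvar K)
    = rscal K lam \<odot>\<^bsub>forms1 K\<^esub> ftheta K (\<tau> f + \<alpha> * f)"
proof -
  have [simp]: "\<tau> f \<in> smooth_functions M"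
    using assms by (simp add: vfield_smooth)
  have "bcomm (forms1 K) (ftheta K f) (tvar K)
      = emb K f \<odot>\<^bsub>forms1 K\<^esub> ftheta K ((\<lambda>_. lam) * \<alpha>) \<oplus>\<^bsub>forms1 K\<^esub> ftheta K ((\<lambda>_. lam) * \<tau> f)"
    unfolding ftheta_def[of K f] using assms
    by (simp add: W.bcomm_lact bcomm_thetap_tvar emb_tvar) (simp add: ftheta_def)
  also have "\<dots> = ftheta K ((\<lambda>_. lam) * (\<alpha> * f)) \<oplus>\<^bsub>forms1 K\<^esub> ftheta K ((\<lambda>_. lam) * \<tau> f)"
    using assms ftheta_mult[of f "(\<lambda>_. lam) * \<alpha>"] by (simp add: mult_ac)
  also have "\<dots> = rscal K lam \<odot>\<^bsub>forms1 K\<^esub> ftheta K (\<tau> f + \<alpha> * f)"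
    using assms by (simp add: ftheta_scale ftheta_add W.lact_add W.B.a_comm)
  finally show ?thesis .
qed

text \<open>
  Both sides are derivations in \<open>a\<close>, so it suffices to compare them on functions and on \<open>t\<close>.  On \<open>t\<close>
  the left side is \<open>\<lambda>\<beta>\<theta>' - \<lambda> dt - \<lambda>(\<tau>s + \<alpha>s)\<theta>'\<close>, and the equation for \<open>s\<close> cancels the multiples of
  \<open>\<theta>'\<close>.
\<close>

lemma bcomm_inner_form:
  assumes s: "s \<in> smooth_functions M" and tau_s: "\<tau> s + \<alpha> * s = \<beta>"
    and a: "a \<in> carrier (alg K)"
  shows "bcomm (forms1 K) (dt K \<ominus>\<^bsub>forms1 K\<^esub> ftheta K s) a
    = \<ominus>\<^bsub>forms1 K\<^esub> (rscal K lam \<odot>\<^bsub>forms1 K\<^esub> dd K a)"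
  using a
proof (induction rule: alg_generated)
  case (emb f)
  then show ?case
    using s by (simp add: W.B.minus_eq W.bcomm_add W.bcomm_uminus bcomm_dt_emb bcomm_ftheta_emb)
next
  case tvar
  have c: "rscal K lam \<odot>\<^bsub>forms1 K\<^esub> ftheta K \<beta> \<in> carrier (forms1 K)"
    "rscal K lam \<odot>\<^bsub>forms1 K\<^esub> dt K \<in> carrier (forms1 K)"
    by simp_all
  have "bcomm (forms1 K) (dt K \<ominus>\<^bsub>forms1 K\<^esub> ftheta K s) (tvar K)
      = rscal K lam \<odot>\<^bsub>forms1 K\<^esub> ftheta K \<beta> \<ominus>\<^bsub>forms1 K\<^esub> rscal K lam \<odot>\<^bsub>forms1 K\<^esub> dt K
        \<ominus>\<^bsub>forms1 K\<^esub> rscal K lam \<odot>\<^bsub>forms1 K\<^esub> ftheta K \<beta>"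
    using s by (simp add: W.bcomm_minus bcomm_dt_tvar bcomm_ftheta_tvar tau_s ftheta_scale)
  also have "\<dots> = \<ominus>\<^bsub>forms1 K\<^esub> (rscal K lam \<odot>\<^bsub>forms1 K\<^esub> dt K)"
    using c by algebra
  finally show ?case
    by (simp add: dt_def)
next
  case (add a b)
  then show ?case
    using s by (simp add: W.bcomm_add_right dd_add W.lact_add W.B.minus_add)
next
  case (mult a b)
  then show ?case
    using s by (simp add: W.bcomm_mult dd_mult W.lact_add W.ract_uminus W.lact_uminus W.B.minus_add
        W.lact_ract WS.rscal_lact_comm)
qed

end

locale conformal_two_forms = conformal_calculus_setting M \<zeta> \<tau> \<beta> lam K + two_form_setting K F
  for M :: "('m::{t2_space,second_countable_topology}, 'n::finite) riemannian"
    and \<zeta> \<tau> \<beta> lam and K :: "('m, 'a, 'w) calculus" and F :: "('a, 'w, 'e) two_forms"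
begin

sublocale ES: scalar_bimod M \<zeta> \<tau> \<beta> lam K F
  by unfold_locales

lemma wedge_rscal_right: "\<lbrakk>x \<in> carrier (forms1 K); y \<in> carrier (forms1 K)\<rbrakk> \<Longrightarrow>
    x \<diamondop>\<^bsub>F\<^esub> (rscal K c \<odot>\<^bsub>forms1 K\<^esub> y) = rscal K c \<odot>\<^bsub>F\<^esub> (x \<diamondop>\<^bsub>F\<^esub> y)"
  using wedge_balanced[of "rscal K c" x y] by (simp add: ract_rscal wedge_lact)

lemma dif_rscal: "x \<in> carrier (forms1 K) \<Longrightarrow>
    dif F (rscal K c \<odot>\<^bsub>forms1 K\<^esub> x) = rscal K c \<odot>\<^bsub>F\<^esub> dif F x"
  by (simp add: dif_lact)

lemma anti_rscal_left: "\<lbrakk>x \<in> carrier (forms1 K); y \<in> carrier (forms1 K)\<rbrakk> \<Longrightarrow>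
    anti F (rscal K c \<odot>\<^bsub>forms1 K\<^esub> x) y = rscal K c \<odot>\<^bsub>F\<^esub> anti F x y"
  by (simp add: anti_def wedge_lact wedge_rscal_right E.lact_add)

text \<open>
  If \<open>y\<close> generates \<open>d\<close> on \<open>a\<close> and on \<open>x\<close>, it generates \<open>d\<close> on \<open>ax\<close>.  This is applied to \<open>y = dt\<close>, which
  generates \<open>d\<close> on functions, and to the inner generator.
\<close>

lemma anti_lact_eq_dif:
  assumes a: "a \<in> carrier (alg K)" and x: "x \<in> carrier (forms1 K)" and y: "y \<in> carrier (forms1 K)"
    and comm: "bcomm (forms1 K) y a = \<ominus>\<^bsub>forms1 K\<^esub> (rscal K lam \<odot>\<^bsub>forms1 K\<^esub> dd K a)"
    and anti: "anti F x y = \<ominus>\<^bsub>F\<^esub> (rscal K lam \<odot>\<^bsub>F\<^esub> dif F x)"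
  shows "anti F (a \<odot>\<^bsub>forms1 K\<^esub> x) y = \<ominus>\<^bsub>F\<^esub> (rscal K lam \<odot>\<^bsub>F\<^esub> dif F (a \<odot>\<^bsub>forms1 K\<^esub> x))"
  using a x y
  by (simp add: anti_lact comm anti dif_lact wedge_uminus_left wedge_lact E.lact_uminus E.lact_add
      ES.rscal_lact_comm E.B.minus_add E.B.a_comm)

end

section \<open>Consequences of the anticommutator of \<open>\<theta>'\<close> and \<open>dt\<close>\<close>

locale theta_dt_setting = conformal_two_forms M \<zeta> \<tau> \<beta> lam K F
  for M :: "('m::{t2_space,second_countable_topology}, 'n::finite) riemannian"
    and \<zeta> \<tau> \<beta> lam and K :: "('m, 'a, 'w) calculus" and F :: "('a, 'w, 'e) two_forms" +
  assumes lam_nonzero: "lam \<noteq> 0"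
    and theta_dt: "rel_theta_dt lam K F"
begin

lemma anti_ftheta_dt:
  assumes "f \<in> smooth_functions M"
  shows "anti F (ftheta K f) (dt K) = \<ominus>\<^bsub>F\<^esub> (rscal K lam \<odot>\<^bsub>F\<^esub> dif F (ftheta K f))"
  unfolding ftheta_def
  using assms theta_dt by (intro anti_lact_eq_dif bcomm_dt_emb) (simp_all add: rel_theta_dt_def)

text \<open>
  The differential of \<open>[dt,t] = \<lambda>\<beta>\<theta>' - \<lambda> dt\<close> is \<open>-2(dt)\<^sup>2 = \<lambda> d(\<beta>\<theta>')\<close>.
\<close>

lemma dt_squared: "rel_dt_dt \<beta> lam K F"
proof -
  let ?q = "dt K \<diamondop>\<^bsub>F\<^esub> dt K"
  let ?D = "rscal K (lam / 2) \<odot>\<^bsub>F\<^esub> dif F (ftheta K \<beta>)"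
  have q: "?q \<in> carrier F" and D: "?D \<in> carrier F"
    by simp_all
  have [simp]: "dif F (dt K) = \<zero>\<^bsub>F\<^esub>"
    by (simp add: dt_def)
  have "dif F (bcomm (forms1 K) (dt K) (tvar K)) = \<ominus>\<^bsub>F\<^esub> anti F (dt K) (dt K)"
    using dif_bcomm[of "tvar K" "dt K"] by (simp add: E.B.minus_eq flip: dt_def)
  moreover have "dif F (bcomm (forms1 K) (dt K) (tvar K)) = rscal K lam \<odot>\<^bsub>F\<^esub> dif F (ftheta K \<beta>)"
    by (simp add: bcomm_dt_tvar ftheta_scale W.B.minus_eq dif_add dif_uminus dif_rscal)
  moreover have "rscal K lam \<odot>\<^bsub>F\<^esub> dif F (ftheta K \<beta>) = ?D \<oplus>\<^bsub>F\<^esub> ?D"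
    by (simp add: ES.rscal_add_left)
  ultimately have "?q \<oplus>\<^bsub>F\<^esub> ?q = \<ominus>\<^bsub>F\<^esub> ?D \<oplus>\<^bsub>F\<^esub> \<ominus>\<^bsub>F\<^esub> ?D"
    using q D by (metis E.B.a_closed E.B.minus_add E.B.minus_minus anti_def)
  then have "rscal K 2 \<odot>\<^bsub>F\<^esub> ?q = rscal K 2 \<odot>\<^bsub>F\<^esub> (\<ominus>\<^bsub>F\<^esub> ?D)"
    using ES.rscal_add_left[of ?q 1 1] ES.rscal_add_left[of "\<ominus>\<^bsub>F\<^esub> ?D" 1 1] q D by simp
  then show ?thesis
    unfolding rel_dt_dt_def using q D by (intro ES.rscal_cancel[of 2 ?q "\<ominus>\<^bsub>F\<^esub> ?D"]) simp_all
qed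

text \<open>
  Differentiate \<open>[f\<theta>',t] = \<lambda>(\<tau>f + \<alpha>f)\<theta>'\<close>; the anticommutator \<open>{f\<theta>',dt} = -\<lambda> d(f\<theta>')\<close> accounts for the
  shift from \<open>\<alpha>\<close> to \<open>\<alpha> - 1\<close>.
\<close>

lemma bcomm_dif_ftheta_tvar:
  assumes f: "f \<in> smooth_functions M"
  shows "bcomm F (dif F (ftheta K f)) (tvar K)
    = rscal K lam \<odot>\<^bsub>F\<^esub> dif F (ftheta K (\<tau> f + f * (\<alpha> - 1)))"
proof -
  let ?g = "\<tau> f + \<alpha> * f"
  have g: "?g \<in> smooth_functions M"
    using f by (simp add: vfield_smooth)
  have c: "bcomm F (dif F (ftheta K f)) (tvar K) \<in> carrier F"
    "rscal K lam \<odot>\<^bsub>F\<^esub> dif F (ftheta K f) \<in> carrier F"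
    "rscal K lam \<odot>\<^bsub>F\<^esub> dif F (ftheta K ?g) \<in> carrier F"
    using f g by simp_all
  have "rscal K lam \<odot>\<^bsub>F\<^esub> dif F (ftheta K ?g)
      = bcomm F (dif F (ftheta K f)) (tvar K) \<oplus>\<^bsub>F\<^esub> rscal K lam \<odot>\<^bsub>F\<^esub> dif F (ftheta K f)"
    using dif_bcomm[of "tvar K" "ftheta K f"] f g
    by (simp add: bcomm_ftheta_tvar dif_rscal anti_ftheta_dt E.B.minus_eq flip: dt_def)
  then have "bcomm F (dif F (ftheta K f)) (tvar K)
      = rscal K lam \<odot>\<^bsub>F\<^esub> dif F (ftheta K ?g) \<ominus>\<^bsub>F\<^esub> rscal K lam \<odot>\<^bsub>F\<^esub> dif F (ftheta K f)"
    using c by (simp only:) algebra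
  also have "\<dots> = rscal K lam \<odot>\<^bsub>F\<^esub> dif F (ftheta K (?g - f))"
    using f g by (simp only: ftheta_diff) (simp add: dif_minus E.lact_minus)
  also have "?g - f = \<tau> f + f * (\<alpha> - 1)"
    by (simp add: algebra_simps)
  finally show ?thesis .
qed

lemma dtheta_t: "rel_dtheta_t M \<tau> lam K F"
  using bcomm_dif_ftheta_tvar[OF smooth_one]
  unfolding rel_dtheta_t_def vfield_one[OF tau_vfield] by (simp only: ftheta_one add_0_left mult_1_left)

text \<open>
  The commutator of \<open>(dt)\<^sup>2 = -(\<lambda>/2) d(\<beta>\<theta>')\<close> with \<open>t\<close> is computed twice.  As \<open>{[dt,t],dt}\<close> it is
  \<open>\<lambda>{\<beta>\<theta>',dt} - 2\<lambda>(dt)\<^sup>2 = 0\<close>, and from the right side it is \<open>-(\<lambda>\<^sup>2/2) d((\<tau>\<beta> + \<beta>(\<alpha>-1))\<theta>')\<close>.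
\<close>

lemma compatibility_closed: "rel_closed K F (\<tau> \<beta> + \<beta> * (\<alpha> - 1))"
proof -
  have [simp]: "\<tau> \<beta> + \<beta> * (\<alpha> - 1) \<in> smooth_functions M"
    by (simp add: vfield_smooth)
  let ?D = "rscal K lam \<odot>\<^bsub>F\<^esub> dif F (ftheta K \<beta>)"
  let ?q = "dt K \<diamondop>\<^bsub>F\<^esub> dt K"
  let ?y = "bcomm (forms1 K) (dt K) (tvar K)"
  have q: "?q = \<ominus>\<^bsub>F\<^esub> (rscal K (lam / 2) \<odot>\<^bsub>F\<^esub> dif F (ftheta K \<beta>))"
    using dt_squared by (simp add: rel_dt_dt_def)
  have qq: "?q \<oplus>\<^bsub>F\<^esub> ?q = \<ominus>\<^bsub>F\<^esub> ?D"
    unfolding q by (simp add: ES.rscal_add_left flip: E.B.minus_add)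
  have "bcomm F ?q (tvar K) = anti F ?y (dt K)"
    by (simp add: bcomm_wedge anti_def E.B.a_comm)
  also have "\<dots> = rscal K lam \<odot>\<^bsub>F\<^esub> (\<ominus>\<^bsub>F\<^esub> ?D) \<ominus>\<^bsub>F\<^esub> rscal K lam \<odot>\<^bsub>F\<^esub> (\<ominus>\<^bsub>F\<^esub> ?D)"
    unfolding bcomm_dt_tvar
    by (simp add: ftheta_scale W.B.minus_eq E.B.minus_eq anti_add_left anti_uminus_left anti_rscal_left
        anti_ftheta_dt qq[folded anti_def])
  also have "\<dots> = \<zero>\<^bsub>F\<^esub>"
    by (simp add: E.B.minus_eq_zero_iff)
  finally have "rscal K (lam / 2) \<odot>\<^bsub>F\<^esub> bcomm F (dif F (ftheta K \<beta>)) (tvar K) = \<zero>\<^bsub>F\<^esub>"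
    unfolding q by (simp add: E.bcomm_uminus ES.bcomm_rscal)
  then have "rscal K (lam / 2) \<odot>\<^bsub>F\<^esub> (rscal K lam \<odot>\<^bsub>F\<^esub> dif F (ftheta K (\<tau> \<beta> + \<beta> * (\<alpha> - 1)))) = \<zero>\<^bsub>F\<^esub>"
    by (simp add: bcomm_dif_ftheta_tvar)
  then show ?thesis
    unfolding rel_closed_def
    using lam_nonzero
    by (intro ES.rscal_cancel[of "lam / 2 * lam" "dif F (ftheta K (\<tau> \<beta> + \<beta> * (\<alpha> - 1)))" "\<zero>\<^bsub>F\<^esub>"])
       (simp_all add: ES.rscal_rscal)
qed

text \<open>
  The differential of \<open>[k,dt] = \<lambda> dk\<close> says that \<open>dk\<close> anticommutes with \<open>dt\<close>.  The classical
  differential of \<open>k\<close> differs from \<open>dk\<close> by a multiple of \<open>\<theta>'\<close>, for which the relation is known, and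
  multiplication by \<open>f\<close> preserves it.
\<close>

lemma exact_form_dt:
  assumes f: "f \<in> smooth_functions M" and k: "k \<in> smooth_functions M"
  shows "rel_form_dt lam K F (f \<rightharpoondown> cl_d M k)"
proof -
  let ?g = "(\<lambda>_. lam / 2) * drift_laplacian M \<zeta> k"
  have g: "?g \<in> smooth_functions M"
    using k by simp
  have d: "dt K \<in> carrier (forms1 K)" "dd K (emb K k) \<in> carrier (forms1 K)"
     "emb1 K (cl_d M k) \<in> carrier (forms1 K)" "ftheta K ?g \<in> carrier (forms1 K)"
    using k g by simp_all
  have "anti F (dt K) (dd K (emb K k)) = \<zero>\<^bsub>F\<^esub>"
  proof -
    have "dif F (dt K) = \<zero>\<^bsub>F\<^esub>"
      by (simp add: dt_def)
    then have "\<ominus>\<^bsub>F\<^esub> anti F (dt K) (dd K (emb K k)) = \<zero>\<^bsub>F\<^esub>"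
      using dif_bcomm[of "emb K k" "dt K"] k
      by (simp add: bcomm_dt_emb E.B.minus_eq dif_uminus dif_rscal)
    then show ?thesis
      by (rule E.B.uminus_eq_zeroD) (use k in simp)
  qed
  then have dk: "anti F (dd K (emb K k)) (dt K) = \<zero>\<^bsub>F\<^esub>"
    using anti_comm[OF d(1,2)] by simp
  have e: "emb1 K (cl_d M k) = dd K (emb K k) \<ominus>\<^bsub>forms1 K\<^esub> ftheta K ?g"
    unfolding dd_emb[OF k] using d by (simp only: W.B.add_minus_cancel)
  have "anti F (emb1 K (cl_d M k)) (dt K)
      = \<ominus>\<^bsub>F\<^esub> (rscal K lam \<odot>\<^bsub>F\<^esub> dif F (emb1 K (cl_d M k)))"
    unfolding e using k g d
    by (simp only: anti_minus_left dif_minus dk anti_ftheta_dt)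
       (simp add: E.B.minus_eq E.lact_uminus)
  then show ?thesis
    unfolding rel_form_dt_def using f k
    by (simp add: emb1_fmul anti_lact_eq_dif bcomm_dt_emb)
qed

end

section \<open>The inner generator\<close>

locale inner_setting = theta_dt_setting M \<zeta> \<tau> \<beta> lam K F
  for M :: "('m::{t2_space,second_countable_topology}, 'n::finite) riemannian"
    and \<zeta> \<tau> \<beta> lam and K :: "('m, 'a, 'w) calculus" and F :: "('a, 'w, 'e) two_forms" +
  fixes s :: "'m scalar_fn"
  assumes manifold_rel: "manifold_relations M lam K F"
    and s_smooth [simp]: "s \<in> smooth_functions M"
    and tau_s: "\<tau> s + \<alpha> * s = \<beta>"
    and closed_s: "rel_closed K F (\<beta> - s)"
begin

lemma anti_thetap_dd_emb:
  assumes "f \<in> smooth_functions M"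
  shows "anti F (thetap K) (dd K (emb K f)) = \<zero>\<^bsub>F\<^esub>"
proof -
  let ?g = "(\<lambda>_. lam / 2) * drift_laplacian M \<zeta> f"
  have g: "?g \<in> smooth_functions M" and f: "cl_d M f \<in> one_forms M"
    using assms by simp_all
  have m: "anti F (emb1 K (cl_d M f)) (thetap K) = \<zero>\<^bsub>F\<^esub>" "thetap K \<diamondop>\<^bsub>F\<^esub> thetap K = \<zero>\<^bsub>F\<^esub>"
    using manifold_rel f by (simp_all add: manifold_relations_def)
  have "anti F (ftheta K ?g) (thetap K) = \<zero>\<^bsub>F\<^esub>"
    unfolding ftheta_def[of K ?g] using g
    by (simp only: anti_lact emb_closed thetap_closed bcomm_thetap_emb) (simp add: anti_def m)
  then have "anti F (dd K (emb K f)) (thetap K) = \<zero>\<^bsub>F\<^esub>"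
    using f g by (simp only: dd_emb[OF assms] anti_add_left emb1_closed ftheta_closed thetap_closed m)
       simp
  then show ?thesis
    using anti_comm[of "thetap K" "dd K (emb K f)"] assms by simp
qed

text \<open>
  By differentiating \<open>[s\<theta>',f] = 0\<close> the claim becomes \<open>{s\<theta>',df} = 0\<close>.  This is \<open>s{\<theta>',df} = 0\<close> up to the
  term \<open>[df,s]\<theta>'\<close>, a multiple of \<open>\<theta>'\<theta>' = 0\<close>.
\<close>

lemma bcomm_dif_ftheta_emb:
  assumes f: "f \<in> smooth_functions M"
  shows "bcomm F (dif F (ftheta K s)) (emb K f) = \<zero>\<^bsub>F\<^esub>"
proof -
  let ?h = "(\<lambda>_. lam) * inv_metric M (cl_d M f) (cl_d M s)"
  let ?g = "(\<lambda>_. lam / 2) * drift_laplacian M \<zeta> f"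
  have h: "?h \<in> smooth_functions M" and g: "?g \<in> smooth_functions M"
    using f by simp_all
  have tt: "thetap K \<diamondop>\<^bsub>F\<^esub> thetap K = \<zero>\<^bsub>F\<^esub>"
    using manifold_rel by (simp add: manifold_relations_def)
  have "bcomm (forms1 K) (dd K (emb K f)) (emb K s) = ftheta K ?h"
    unfolding dd_emb[OF f] using f g h
    by (simp only: W.bcomm_add emb_closed emb1_closed cl_d_oneform ftheta_closed bcomm_emb1_emb
        bcomm_ftheta_emb s_smooth W.B.r_zero)
  moreover have "ftheta K ?h \<diamondop>\<^bsub>F\<^esub> thetap K = \<zero>\<^bsub>F\<^esub>"
    unfolding ftheta_def using h by (simp only: wedge_lact emb_closed thetap_closed tt E.lact_zero)
  ultimately have "anti F (ftheta K s) (dd K (emb K f)) = \<zero>\<^bsub>F\<^esub>"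
    unfolding ftheta_def[of K s] using f by (simp add: anti_lact anti_thetap_dd_emb)
  then show ?thesis
    using dif_bcomm[of "emb K f" "ftheta K s"] f by (simp add: bcomm_ftheta_emb E.B.minus_eq)
qed

text \<open>
  Centrality of \<open>d(s\<theta>')\<close>.  On \<open>t\<close> it amounts to the closedness of \<open>(\<beta>-s)\<theta>'\<close>, since
  \<open>\<tau>s + s(\<alpha>-1) = \<beta> - s\<close>.
\<close>

lemma bcomm_dif_ftheta:
  assumes "a \<in> carrier (alg K)"
  shows "bcomm F (dif F (ftheta K s)) a = \<zero>\<^bsub>F\<^esub>"
  using assms
proof (induction rule: alg_generated)
  case (emb f)
  then show ?case by (rule bcomm_dif_ftheta_emb)
next
  case tvar
  have "\<tau> s + s * (\<alpha> - 1) = \<beta> - s"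
    using tau_s by (simp add: algebra_simps)
  then show ?case
    using closed_s by (simp add: bcomm_dif_ftheta_tvar rel_closed_def)
next
  case (add a b)
  then show ?case by (simp add: E.bcomm_add_right)
next
  case (mult a b)
  then show ?case by (simp add: E.bcomm_mult)
qed

lemma inner: "inner_by lam K F (dt K \<ominus>\<^bsub>forms1 K\<^esub> ftheta K s)"
proof -
  let ?\<theta> = "dt K \<ominus>\<^bsub>forms1 K\<^esub> ftheta K s"
  have \<theta>: "?\<theta> \<in> carrier (forms1 K)"
    by simp
  have deg0: "bcomm (forms1 K) ?\<theta> a = \<ominus>\<^bsub>forms1 K\<^esub> (rscal K lam \<odot>\<^bsub>forms1 K\<^esub> dd K a)"
    if "a \<in> carrier (alg K)" for a
    using that by (intro bcomm_inner_form tau_s) simp_all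
  have exact: "anti F (dd K b) ?\<theta> = \<zero>\<^bsub>F\<^esub>" if b: "b \<in> carrier (alg K)" for b
  proof -
    have "dif F (dt K) = \<zero>\<^bsub>F\<^esub>"
      by (simp add: dt_def)
    then have "dif F ?\<theta> = \<ominus>\<^bsub>F\<^esub> dif F (ftheta K s)"
      by (simp add: dif_minus E.B.minus_eq)
    then have "bcomm F (dif F ?\<theta>) b = \<zero>\<^bsub>F\<^esub>"
      using b by (simp add: E.bcomm_uminus bcomm_dif_ftheta)
    then have "\<ominus>\<^bsub>F\<^esub> anti F ?\<theta> (dd K b) = \<zero>\<^bsub>F\<^esub>"
      using dif_bcomm[OF b \<theta>] b by (simp add: deg0 dif_uminus dif_rscal E.B.minus_eq)
    then have "anti F ?\<theta> (dd K b) = \<zero>\<^bsub>F\<^esub>"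
      by (rule E.B.uminus_eq_zeroD) (use b in simp)
    then show ?thesis
      using anti_comm[OF \<theta>, of "dd K b"] b by simp
  qed
  have "anti F x ?\<theta> = \<ominus>\<^bsub>F\<^esub> (rscal K lam \<odot>\<^bsub>F\<^esub> dif F x)" if "x \<in> carrier (forms1 K)" for x
    using that
  proof (induction rule: forms1_generated)
    case (adb a b)
    then show ?case
      by (intro anti_lact_eq_dif \<theta> deg0) (simp_all add: exact)
  next
    case (add x y)
    then show ?case
      by (simp add: anti_add_left dif_add E.lact_add E.B.minus_add)
  qed
  then show ?thesis
    unfolding inner_by_def using deg0 anti_comm[OF \<theta>] by simp
qed

end

section \<open>Universal natural extensions\<close>

context conformal_calculus_setting
begin

text \<open>
  The natural relations as pairs of formal sums of products, a form in which the maximal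
  prolongation can be divided by them.  The relation \<open>[d\<theta>',f] = 0\<close> is read as \<open>(d\<theta>')f = f d\<theta>'\<close>.
\<close>

definition natural_pairs :: "'m scalar_fn \<Rightarrow> (('w \<times> 'w) list \<times> ('w \<times> 'w) list) set" where
  "natural_pairs h =
     (\<Union>\<omega>\<in>one_forms M. {([(emb1 K \<omega>, thetap K), (thetap K, emb1 K \<omega>)], []),
        ([(emb1 K \<omega>, dt K), (dt K, emb1 K \<omega>)], fneg (flact (rscal K lam) (fdif (emb1 K \<omega>))))}) \<union>
     (\<Union>f\<in>smooth_functions M. {(fract (fdif (thetap K)) (emb K f), flact (emb K f) (fdif (thetap K)))}) \<union>
     (\<Union>\<omega>\<in>one_forms M. \<Union>\<eta>\<in>one_forms M. {([(emb1 K \<omega>, emb1 K \<eta>), (emb1 K \<eta>, emb1 K \<omega>)],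
        flact (rscal K lam) [(thetap K, emb1 K (nabla_form M \<omega> \<eta> + nabla_form M \<eta> \<omega>))]
        @ fneg (flact (emb K ((\<lambda>_. lam) * inv_metric M \<omega> \<eta>)) (fdif (thetap K))))}) \<union>
     {([(thetap K, thetap K)], []),
      ([(thetap K, dt K), (dt K, thetap K)], fneg (flact (rscal K lam) (fdif (thetap K)))),
      ([(dt K, dt K)], fneg (flact (rscal K (lam / 2)) (fdif (ftheta K \<beta>)))),
      (fract (fdif (thetap K)) (tvar K) @ fneg (flact (tvar K) (fdif (thetap K))),
       flact (rscal K lam) (fdif (ftheta K (\<alpha> - 1)))),
      (fdif (ftheta K h), [])}"

lemma natural_pairs_formal:
  assumes "h \<in> smooth_functions M" "(u, v) \<in> natural_pairs h"
  shows "u \<in> formal_products" "v \<in> formal_products"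
  using assms unfolding natural_pairs_def by auto

end

lemma (in conformal_two_forms) natural_relations_iff_pairs:
  assumes h: "h \<in> smooth_functions M"
  shows "natural_relations M \<tau> \<beta> lam h K F \<longleftrightarrow> (\<forall>(u, v)\<in>natural_pairs h. ev u = ev v)"
  unfolding natural_relations_def manifold_relations_def rel_theta_dt_def rel_dt_dt_def
    rel_dtheta_t_def rel_form_dt_def rel_closed_def natural_pairs_def anti_def
  using h
  by (simp add: ball_Un ev_append ev_fneg ev_flact ev_fract ev_fdif wedge_lact E.bcomm_eq_zero_iff
      bcomm_def[of F _ "tvar K"] E.B.minus_eq) blast

lemma (in conformal_calculus_setting) natural_extension_universal:
  assumes h: "h \<in> smooth_functions M"
  shows "\<exists>E :: ('a, 'w, ('w \<times> 'w) list set) two_forms.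
    two_form_extension K E \<and> generated_by_products K E \<and> natural_relations M \<tau> \<beta> lam h K E \<and>
    (\<forall>F :: ('a, 'w, 'e) two_forms.
       two_form_extension K F \<and> natural_relations M \<tau> \<beta> lam h K F \<longrightarrow> (\<exists>q. extension_hom K E F q))"
proof (intro exI[of _ "prolongation (natural_pairs h)"] conjI allI impI)
  show ext: "two_form_extension K (prolongation (natural_pairs h))"
    by (rule prolongation_extension)
  show "generated_by_products K (prolongation (natural_pairs h))"
    by (rule prolongation_generated_by_products)
  interpret E: conformal_two_forms M \<zeta> \<tau> \<beta> lam K "prolongation (natural_pairs h)"
    by unfold_locales (rule ext)
  show "natural_relations M \<tau> \<beta> lam h K (prolongation (natural_pairs h))"
    unfolding E.natural_relations_iff_pairs[OF h]
    using natural_pairs_formal[OF h] prolongation_satisfies by fast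
next
  fix F :: "('a, 'w, 'e) two_forms"
  assume F: "two_form_extension K F \<and> natural_relations M \<tau> \<beta> lam h K F"
  interpret F: conformal_two_forms M \<zeta> \<tau> \<beta> lam K F
    by unfold_locales (use F in simp)
  show "\<exists>q. extension_hom K (prolongation (natural_pairs h)) F q"
    using F unfolding F.natural_relations_iff_pairs[OF h]
    by (intro F.prolongation_universal) blast
qed

theorem proposition3p6:
  fixes M :: "('m::{t2_space,second_countable_topology}, 'n::finite) riemannian"
    and \<zeta> \<tau> :: "'m vfield" and \<beta> :: "'m scalar_fn" and lam :: real
    and K :: "('m, 'a, 'w) calculus"
  assumes "riemannian_manifold M"
    and "\<zeta> \<in> vector_fields M"
    and "\<beta> \<in> smooth_functions M"
    and "conformal_killing M \<tau>"
    and "lam \<noteq> 0"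
    and "conformal_calculus M \<zeta> \<tau> \<beta> lam K"
  shows
    "(let h = \<tau> \<beta> + \<beta> * (alpha M \<tau> - 1) in
       (\<exists>E :: ('a, 'w, ('w \<times> 'w) list set) two_forms.
          two_form_extension K E \<and> generated_by_products K E \<and>
          natural_relations M \<tau> \<beta> lam h K E \<and>
          (\<forall>F :: ('a, 'w, 'e) two_forms.
             two_form_extension K F \<and> natural_relations M \<tau> \<beta> lam h K F \<longrightarrow>
             (\<exists>q. extension_hom K E F q))) \<and>
       (\<forall>F :: ('a, 'w, 'e) two_forms.
          two_form_extension K F \<and> manifold_relations M lam K F \<and> rel_theta_dt lam K F \<longrightarrow>
          rel_dt_dt \<beta> lam K F \<and> rel_dtheta_t M \<tau> lam K F \<and> rel_closed K F h \<and>
          (\<forall>f\<in>smooth_functions M. \<forall>k\<in>smooth_functions M.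
             rel_form_dt lam K F (f \<rightharpoondown> cl_d M k)))) \<and>
     (\<forall>\<mu>\<in>smooth_functions M. \<forall>\<nu>\<in>smooth_functions M.
        \<tau> \<mu> = \<beta> - (1 + alpha M \<tau>) * \<mu> \<and> \<tau> \<nu> = \<mu> - alpha M \<tau> * \<nu> \<longrightarrow>
        (\<exists>E :: ('a, 'w, ('w \<times> 'w) list set) two_forms.
           two_form_extension K E \<and> generated_by_products K E \<and>
           natural_relations M \<tau> \<beta> lam (\<beta> - (\<mu> + \<nu>)) K E \<and>
           (\<forall>F :: ('a, 'w, 'e) two_forms.
              two_form_extension K F \<and> natural_relations M \<tau> \<beta> lam (\<beta> - (\<mu> + \<nu>)) K F \<longrightarrow>
              (\<exists>q. extension_hom K E F q))) \<and>
        (\<forall>F :: ('a, 'w, 'e) two_forms.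
           two_form_extension K F \<and> natural_relations M \<tau> \<beta> lam (\<beta> - (\<mu> + \<nu>)) K F \<longrightarrow>
           rel_closed K F (\<tau> \<beta> + \<beta> * (alpha M \<tau> - 1)) \<and>
           inner_by lam K F (dt K \<ominus>\<^bsub>forms1 K\<^esub> ftheta K (\<mu> + \<nu>))))"
proof -
  interpret conformal_calculus_setting M \<zeta> \<tau> \<beta> lam K
    using assms by unfold_locales (simp_all add: conformal_killing_def)
  have setting: "theta_dt_setting M \<zeta> \<tau> \<beta> lam K F"
    if "two_form_extension K F" "rel_theta_dt lam K F" for F :: "('a, 'w, 'e) two_forms"
    using that assms(5) by unfold_locales
  have h: "\<tau> \<beta> + \<beta> * (alpha M \<tau> - 1) \<in> smooth_functions M"
    by (simp add: vfield_smooth)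
  have part2: "rel_closed K F (\<tau> \<beta> + \<beta> * (alpha M \<tau> - 1)) \<and>
      inner_by lam K F (dt K \<ominus>\<^bsub>forms1 K\<^esub> ftheta K (\<mu> + \<nu>))"
    if \<mu>: "\<mu> \<in> smooth_functions M" and \<nu>: "\<nu> \<in> smooth_functions M"
      and eqs: "\<tau> \<mu> = \<beta> - (1 + alpha M \<tau>) * \<mu> \<and> \<tau> \<nu> = \<mu> - alpha M \<tau> * \<nu>"
      and F: "two_form_extension K F \<and> natural_relations M \<tau> \<beta> lam (\<beta> - (\<mu> + \<nu>)) K F"
    for \<mu> \<nu> and F :: "('a, 'w, 'e) two_forms"
  proof -
    have "\<tau> (\<mu> + \<nu>) = \<tau> \<mu> + \<tau> \<nu>"
      using \<mu> \<nu> by (rule vfield_add[OF tau_vfield])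
    then have "\<tau> (\<mu> + \<nu>) + alpha M \<tau> * (\<mu> + \<nu>) = \<beta>"
      using eqs by (simp add: algebra_simps)
    then interpret inner_setting M \<zeta> \<tau> \<beta> lam K F "\<mu> + \<nu>"
      using F \<mu> \<nu> assms(5) by unfold_locales (auto simp: natural_relations_def)
    show ?thesis
      using compatibility_closed inner by blast
  qed
  show ?thesis
    unfolding Let_def
  proof (intro conjI ballI allI impI)
    fix F :: "('a, 'w, 'e) two_forms"
    assume F: "two_form_extension K F \<and> manifold_relations M lam K F \<and> rel_theta_dt lam K F"
    then interpret theta_dt_setting M \<zeta> \<tau> \<beta> lam K F
      by (intro setting) simp_all
    show "rel_dt_dt \<beta> lam K F" "rel_dtheta_t M \<tau> lam K F"
      "rel_closed K F (\<tau> \<beta> + \<beta> * (alpha M \<tau> - 1))"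
      by (rule dt_squared dtheta_t compatibility_closed)+
    fix f k assume "f \<in> smooth_functions M" "k \<in> smooth_functions M"
    then show "rel_form_dt lam K F (f \<rightharpoondown> cl_d M k)"
      by (rule exact_form_dt)
  next
    fix \<mu> \<nu> assume \<mu>\<nu>: "\<mu> \<in> smooth_functions M" "\<nu> \<in> smooth_functions M"
      "\<tau> \<mu> = \<beta> - (1 + alpha M \<tau>) * \<mu> \<and> \<tau> \<nu> = \<mu> - alpha M \<tau> * \<nu>"
    then show "\<exists>E :: ('a, 'w, ('w \<times> 'w) list set) two_forms.
        two_form_extension K E \<and> generated_by_products K E \<and>
        natural_relations M \<tau> \<beta> lam (\<beta> - (\<mu> + \<nu>)) K E \<and>
        (\<forall>F :: ('a, 'w, 'e) two_forms.
           two_form_extension K F \<and> natural_relations M \<tau> \<beta> lam (\<beta> - (\<mu> + \<nu>)) K F \<longrightarrow>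
           (\<exists>q. extension_hom K E F q))"
      by (intro natural_extension_universal) simp
    fix F :: "('a, 'w, 'e) two_forms"
    assume "two_form_extension K F \<and> natural_relations M \<tau> \<beta> lam (\<beta> - (\<mu> + \<nu>)) K F"
    from part2[OF \<mu>\<nu> this]
    show "rel_closed K F (\<tau> \<beta> + \<beta> * (alpha M \<tau> - 1))"
      "inner_by lam K F (dt K \<ominus>\<^bsub>forms1 K\<^esub> ftheta K (\<mu> + \<nu>))"
      by simp_all
  qed (rule natural_extension_universal[OF h])
qed

end
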